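(* Let $\pi$ be a Dyck path of size $N$ ending with $k$ East steps, and let $(\epsilon_1,\dots,\epsilon_{2N-k},+^k)$ be the corresponding sequence of signs, reading $\pi$ from bottom left to top right, where a plus denotes an East step and a minus denotes a North step. Then for $f\in V_k$, $$\big(d_{\epsilon_1}\cdots d_{\epsilon_{2N-k}}(f)\big)[-1]=(-1)^Nq^{\mathrm{area}(\pi)}\,f[-q^k]\big|_{y_i=q^{i-1}}.$$
   Context: Plethysm. $\mathrm{Sym}[X]$ is the ring of symmetric functions over $\mathbb{Q}(q,t)$ in $X=x_1+x_2+\cdots$. For an expression $A$, $p_n[A]$ is obtained by replacing every variable and parameter (including $q,t,x_i,y_i$) by its $n$-th power (with $p_n[-A]=-p_n[A]$), and $F[A]$ is the image of $F\in\mathrm{Sym}[X]$ under $p_n\mapsto p_n[A]$ (coefficients fixed); e.g. $F[-1]$ is $p_n\mapsto-1$ and $F[-q^k]$ is $p_n\mapsto-q^{nk}$. $\mathrm{Exp}[A]=\sum_{n\ge0}h_n[A]$. Operators. $V_k=\mathrm{Sym}[X]\otimes\mathbb{Q}[y_1,\dots,y_k]$; plethystic substitutions act on the $\mathrm{Sym}[X]$ factor only, so $f[-q^k]|_{y_i=q^{i-1}}$ means substituting $p_n\mapsto-q^{nk}$ and $y_i\mapsto q^{i-1}$ for $1\le i\le k$. For $1\le i\le k-1$, $T_i:V_k\to V_k$ is $T_iP=\frac{(q-1)y_iP+(y_{i+1}-qy_i)s_iP}{y_{i+1}-y_i}$, where $s_i$ exchanges $y_i$ and $y_{i+1}$. Define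 $d_+:V_k\to V_{k+1}$ and $d_-:V_k\to V_{k-1}$ ($k\ge1$) by $$d_+F=T_1\cdots T_k\big(F[X+(q-1)y_{k+1}]\big),\qquad d_-F=-F[X-(q-1)y_k]\,\mathrm{Exp}[-y_k^{-1}X]\big|_{y_k^{-1}},$$ where $|_{y_k^{-1}}$ is the coefficient of $y_k^{-1}$. A Dyck path of size $N$ is a grid path from $(0,0)$ to $(N,N)$ of unit North and East steps staying weakly above the diagonal; $\mathrm{area}(\pi)$ is the number of unit cells with top right corner $(i,j)$, $i<j$, lying under the path. *)

theory Defs
  imports
    "HOL-Library.Poly_Mapping"
    "HOL-Computational_Algebra.Computational_Algebra"
begin

section \<open>Symmetric functions\<close>

text \<open>
  A monomial is an exponent vector of type \<^typ>\<open>nat \<Rightarrow>\<^sub>0 nat\<close>.  A formal power series in countably many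
  variables with coefficients in a ring is the function that maps a monomial to its coefficient;
  the symmetric functions are those of bounded degree that are invariant under all permutations of
  the variables.
\<close>

abbreviation (input) expo :: "(nat \<Rightarrow>\<^sub>0 nat) \<Rightarrow> nat \<Rightarrow> nat"
  where "expo \<equiv> Poly_Mapping.lookup"

definition mdeg :: "(nat \<Rightarrow>\<^sub>0 nat) \<Rightarrow> nat"
  where "mdeg m = (\<Sum>i\<in>Poly_Mapping.keys m. expo m i)"

definition bounded_degree :: "((nat \<Rightarrow>\<^sub>0 nat) \<Rightarrow> 'a::zero) \<Rightarrow> bool"
  where "bounded_degree f \<longleftrightarrow> (\<exists>d. \<forall>m. f m \<noteq> 0 \<longrightarrow> mdeg m \<le> d)"

definition permutation_invariant :: "((nat \<Rightarrow>\<^sub>0 nat) \<Rightarrow> 'a) \<Rightarrow> bool"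
  where "permutation_invariant f \<longleftrightarrow> (\<forall>\<sigma>. bij \<sigma> \<longrightarrow> (\<forall>m. f (Poly_Mapping.map_key \<sigma> m) = f m))"

lemma lookup_map_key_bij: "bij \<sigma> \<Longrightarrow> expo (Poly_Mapping.map_key \<sigma> m) i = expo m (\<sigma> i)"
  by (simp add: map_key.rep_eq bij_is_inj)

lemma mdeg_superset:
  assumes "finite A" "Poly_Mapping.keys m \<subseteq> A"
  shows "mdeg m = (\<Sum>i\<in>A. expo m i)"
  unfolding mdeg_def using assms by (intro sum.mono_neutral_left) (auto simp: in_keys_iff)

lemma mdeg_add: "mdeg (a + b) = mdeg a + mdeg b"
proof -
  let ?A = "Poly_Mapping.keys a \<union> Poly_Mapping.keys b"
  have "mdeg (a + b) = (\<Sum>i\<in>?A. expo (a + b) i)"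
    by (rule mdeg_superset) (use Poly_Mapping.keys_add[of a b] in auto)
  also have "\<dots> = mdeg a + mdeg b"
    by (simp add: lookup_add sum.distrib mdeg_superset[of ?A a] mdeg_superset[of ?A b])
  finally show ?thesis .
qed

lemma mdeg_0 [simp]: "mdeg 0 = 0"
  by (simp add: mdeg_def)

lemma expo_le_mdeg: "expo m i \<le> mdeg m"
proof (cases "i \<in> Poly_Mapping.keys m")
  case True
  then show ?thesis unfolding mdeg_def by (intro member_le_sum) auto
qed (simp add: in_keys_iff)

lemma finite_splits: "finite {(a, b). a + b = (m :: nat \<Rightarrow>\<^sub>0 nat)}"
proof -
  let ?S = "{a. \<forall>i. expo a i \<le> expo m i}"
  let ?F = "{g. \<forall>i. (i \<in> Poly_Mapping.keys m \<longrightarrow> g i \<in> {..mdeg m}) \<and> (i \<notin> Poly_Mapping.keys m \<longrightarrow> g i = 0)}"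
  have "expo ` ?S \<subseteq> ?F"
  proof (intro image_subsetI CollectI allI conjI impI)
    fix a i
    assume "a \<in> ?S"
    then have le: "expo a i \<le> expo m i"
      by simp
    then show "expo a i \<in> {..mdeg m}"
      using expo_le_mdeg[of m i] by simp
    show "expo a i = 0" if "i \<notin> Poly_Mapping.keys m"
      using le that by (simp add: in_keys_iff)
  qed
  moreover have "finite ?F"
    by (rule finite_set_of_finite_funs) auto
  ultimately have "finite (expo ` ?S)"
    by (rule finite_subset)
  moreover have "inj_on expo ?S"
    by (auto intro!: inj_onI poly_mapping_eqI)
  ultimately have S: "finite ?S"
    by (rule finite_imageD)
  have "{(a, b). a + b = m} \<subseteq> ?S \<times> ?S"
    by (auto simp: lookup_add)
  then show ?thesis
    using S finite_subset by blast
qed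

definition conv :: "((nat \<Rightarrow>\<^sub>0 nat) \<Rightarrow> 'a::comm_ring_1) \<Rightarrow> ((nat \<Rightarrow>\<^sub>0 nat) \<Rightarrow> 'a) \<Rightarrow> (nat \<Rightarrow>\<^sub>0 nat) \<Rightarrow> 'a"
  where "conv f g m = (\<Sum>(a, b) | a + b = m. f a * g b)"

lemma conv_commute: "conv f g = conv g f"
proof
  fix m
  show "conv f g m = conv g f m"
    unfolding conv_def
    by (rule sum.reindex_bij_witness[of _ prod.swap prod.swap]) (auto simp: add.commute mult.commute)
qed

lemma conv_assoc: "conv (conv f g) h = conv f (conv g h)"
proof
  fix m :: "nat \<Rightarrow>\<^sub>0 nat"
  have "conv (conv f g) h m =
      (\<Sum>p | fst p + snd p = m. \<Sum>r | fst r + snd r = fst p. f (fst r) * g (snd r) * h (snd p))"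
    by (simp add: conv_def case_prod_unfold sum_distrib_right)
  also have "\<dots> = (\<Sum>(p, r)\<in>(SIGMA p:{p. fst p + snd p = m}. {r. fst r + snd r = fst p}).
      f (fst r) * g (snd r) * h (snd p))"
    using finite_splits by (intro sum.Sigma) (auto simp: case_prod_unfold)
  also have "\<dots> = (\<Sum>(p, r)\<in>(SIGMA p:{p. fst p + snd p = m}. {r. fst r + snd r = snd p}).
      f (fst p) * (g (fst r) * h (snd r)))"
    by (rule sum.reindex_bij_witness
        [of _ "\<lambda>((a, b), (c, d)). ((a + c, d), (a, c))" "\<lambda>((a, b), (c, d)). ((c, d + b), (d, b))"])
      (auto simp: add.assoc mult.assoc)
  also have "\<dots> = (\<Sum>p | fst p + snd p = m. \<Sum>r | fst r + snd r = snd p. f (fst p) * (g (fst r) * h (snd r)))"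
    using finite_splits by (intro sum.Sigma[symmetric]) (auto simp: case_prod_unfold)
  also have "\<dots> = conv f (conv g h) m"
    by (simp add: conv_def case_prod_unfold sum_distrib_left)
  finally show "conv (conv f g) h m = conv f (conv g h) m" .
qed

lemma conv_add_left: "conv (\<lambda>m. f m + g m) h = (\<lambda>m. conv f h m + conv g h m)"
  by (rule ext) (simp add: conv_def case_prod_unfold distrib_right sum.distrib)

lemma conv_one: "conv (\<lambda>m. if m = 0 then 1 else 0) f = f"
proof
  fix m
  have "conv (\<lambda>m. if m = 0 then 1 else 0) f m
      = (\<Sum>(a, b) | a + b = m. if a = 0 then f b else 0)"
    unfolding conv_def by (rule sum.cong) auto
  also have "\<dots> = (\<Sum>(a, b)\<in>{(0 :: nat \<Rightarrow>\<^sub>0 nat, m)}. if a = 0 then f b else 0)"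
    by (rule sum.mono_neutral_right[OF finite_splits]) (auto split: if_splits)
  finally show "conv (\<lambda>m. if m = 0 then 1 else 0) f m = f m"
    by simp
qed

lemma bounded_degree_conv:
  assumes "bounded_degree f" "bounded_degree g"
  shows "bounded_degree (conv f g)"
proof -
  obtain d e where "\<forall>m. f m \<noteq> 0 \<longrightarrow> mdeg m \<le> d" "\<forall>m. g m \<noteq> 0 \<longrightarrow> mdeg m \<le> e"
    using assms unfolding bounded_degree_def by blast
  then have d: "\<And>m. f m \<noteq> 0 \<Longrightarrow> mdeg m \<le> d" and e: "\<And>m. g m \<noteq> 0 \<Longrightarrow> mdeg m \<le> e"
    by blast+
  have "mdeg m \<le> d + e" if nz: "conv f g m \<noteq> 0" for m
  proof -
    obtain p where "p \<in> {(a, b). a + b = m}" "(case p of (a, b) \<Rightarrow> f a * g b) \<noteq> 0"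
      by (rule sum.not_neutral_contains_not_neutral[OF nz[unfolded conv_def]])
    then obtain a b where ab: "a + b = m" "f a * g b \<noteq> 0"
      by auto
    then have "f a \<noteq> 0" "g b \<noteq> 0"
      by auto
    then show ?thesis
      using d[of a] e[of b] ab(1) by (auto simp: mdeg_add)
  qed
  then show ?thesis
    by (auto simp: bounded_degree_def)
qed

lemma permutation_invariant_conv:
  assumes f: "permutation_invariant f" and g: "permutation_invariant g"
  shows "permutation_invariant (conv f g)"
  unfolding permutation_invariant_def
proof (intro allI impI)
  fix \<sigma> :: "nat \<Rightarrow> nat" and m
  assume s: "bij \<sigma>"
  let ?k = "Poly_Mapping.map_key \<sigma>" and ?l = "Poly_Mapping.map_key (inv \<sigma>)"
  have s': "bij (inv \<sigma>)"
    using s by (rule bij_imp_bij_inv)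
  have kl: "?k (?l a) = a" "?l (?k a) = a" for a :: "nat \<Rightarrow>\<^sub>0 nat"
    using s s' by (auto intro!: poly_mapping_eqI simp: lookup_map_key_bij bij_inv_eq_iff bij_is_inj bij_is_surj surj_f_inv_f)
  have add: "?k (a + b) = ?k a + ?k b" "?l (a + b) = ?l a + ?l b" for a b :: "nat \<Rightarrow>\<^sub>0 nat"
    using s s' by (auto intro!: poly_mapping_eqI simp: lookup_map_key_bij lookup_add)
  have inv: "f (?k a) = f a" "g (?k a) = g a" for a
    using f g s by (auto simp: permutation_invariant_def)
  show "conv f g (?k m) = conv f g m"
    unfolding conv_def
  proof (rule sum.reindex_bij_witness[of _ "map_prod ?k ?k" "map_prod ?l ?l"], goal_cases)
    case (5 a)
    show ?case
      using inv[of "?l (fst a)"] inv[of "?l (snd a)"]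
      by (simp add: case_prod_unfold kl)
  qed (auto simp: kl add[symmetric])
qed

typedef (overloaded) 'a symfun =
  "{f :: (nat \<Rightarrow>\<^sub>0 nat) \<Rightarrow> 'a::comm_ring_1. bounded_degree f \<and> permutation_invariant f}"
  morphisms sym_coeff Abs_symfun
  by (rule exI[of _ "\<lambda>_. 0"]) (simp add: bounded_degree_def permutation_invariant_def)

setup_lifting type_definition_symfun

lemma map_key_eq_0_iff:
  fixes \<sigma> :: "nat \<Rightarrow> nat" and m :: "nat \<Rightarrow>\<^sub>0 nat"
  assumes s: "bij \<sigma>"
  shows "Poly_Mapping.map_key \<sigma> m = 0 \<longleftrightarrow> m = 0"
proof
  assume a: "Poly_Mapping.map_key \<sigma> m = 0"
  show "m = 0"
  proof (rule poly_mapping_eqI)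
    fix i
    have "expo m (\<sigma> (inv \<sigma> i)) = 0"
      using lookup_map_key_bij[OF s, of m "inv \<sigma> i"] a by simp
    then show "expo m i = expo 0 i"
      using s by (simp add: bij_is_surj surj_f_inv_f)
  qed
qed (use s in \<open>auto intro!: poly_mapping_eqI simp: lookup_map_key_bij\<close>)

lemma mdeg_map_key: "bij \<sigma> \<Longrightarrow> mdeg (Poly_Mapping.map_key \<sigma> m) = mdeg m"
  unfolding mdeg_def
  by (rule sum.reindex_bij_witness[of _ "inv \<sigma>" \<sigma>])
    (auto simp: in_keys_iff lookup_map_key_bij bij_is_inj bij_is_surj surj_f_inv_f)

instantiation symfun :: (comm_ring_1) comm_ring_1
begin

lift_definition zero_symfun :: "'a symfun" is "\<lambda>_. 0"
  by (simp add: bounded_degree_def permutation_invariant_def)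

lift_definition one_symfun :: "'a symfun" is "\<lambda>m. if m = 0 then 1 else 0"
  by (auto simp: bounded_degree_def permutation_invariant_def map_key_eq_0_iff)

lift_definition plus_symfun :: "'a symfun \<Rightarrow> 'a symfun \<Rightarrow> 'a symfun" is "\<lambda>f g m. f m + g m"
proof (intro conjI; elim conjE)
  fix f g :: "(nat \<Rightarrow>\<^sub>0 nat) \<Rightarrow> 'a"
  assume "bounded_degree f" "bounded_degree g"
  then obtain d e where "\<forall>m. f m \<noteq> 0 \<longrightarrow> mdeg m \<le> d" "\<forall>m. g m \<noteq> 0 \<longrightarrow> mdeg m \<le> e"
    unfolding bounded_degree_def by blast
  then have d: "\<And>m. f m \<noteq> 0 \<Longrightarrow> mdeg m \<le> d" and e: "\<And>m. g m \<noteq> 0 \<Longrightarrow> mdeg m \<le> e"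
    by blast+
  have "mdeg m \<le> max d e" if "f m + g m \<noteq> 0" for m
    using that d[of m] e[of m] by (cases "f m = 0") auto
  then show "bounded_degree (\<lambda>m. f m + g m)"
    by (auto simp: bounded_degree_def)
qed (simp add: permutation_invariant_def)

lift_definition uminus_symfun :: "'a symfun \<Rightarrow> 'a symfun" is "\<lambda>f m. - f m"
  by (auto simp: bounded_degree_def permutation_invariant_def)

lift_definition times_symfun :: "'a symfun \<Rightarrow> 'a symfun \<Rightarrow> 'a symfun" is conv
  by (auto intro: bounded_degree_conv permutation_invariant_conv)

definition minus_symfun :: "'a symfun \<Rightarrow> 'a symfun \<Rightarrow> 'a symfun"
  where "minus_symfun f g = f + - g"

instance
proof
  fix a b c :: "'a symfun"
  show "a * b * c = a * (b * c)"
    by transfer (rule conv_assoc)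
  show "a * b = b * a"
    by transfer (rule conv_commute)
  show "1 * a = a"
    by transfer (rule conv_one)
  show "(a + b) * c = a * c + b * c"
    by transfer (rule conv_add_left)
  show "a + b + c = a + (b + c)"
    by transfer (simp add: add.assoc)
  show "a + b = b + a"
    by transfer (simp add: add.commute)
  show "0 + a = a"
    by transfer simp
  show "- a + a = 0"
    by transfer simp
  show "a - b = a + - b"
    by (rule minus_symfun_def)
  show "(0::'a symfun) \<noteq> 1"
  proof
    assume "(0::'a symfun) = 1"
    then have "sym_coeff (0::'a symfun) 0 = sym_coeff (1::'a symfun) 0"
      by simp
    then show False
      by (simp add: zero_symfun.rep_eq one_symfun.rep_eq)
  qed
qed

end

lift_definition sym_const :: "'a::comm_ring_1 \<Rightarrow> 'a symfun" is "\<lambda>c m. if m = 0 then c else 0"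
  by (auto simp: bounded_degree_def permutation_invariant_def map_key_eq_0_iff)

text \<open>Power sums \<open>p\<^sub>n = x\<^sub>0\<^sup>n + x\<^sub>1\<^sup>n + \<dots>\<close>, for \<open>n \<ge> 1\<close> (the value at \<open>n = 0\<close> is irrelevant).\<close>

lift_definition sym_p :: "nat \<Rightarrow> 'a::comm_ring_1 symfun"
  is "\<lambda>n m. if \<exists>i. m = Poly_Mapping.single i n then 1 else 0"
proof (intro conjI)
  fix n
  show "bounded_degree (\<lambda>m. if \<exists>i. m = Poly_Mapping.single i n then 1 else (0::'a))"
    unfolding bounded_degree_def by (rule exI[of _ n]) (auto simp: mdeg_def)
  have "(\<exists>i. Poly_Mapping.map_key \<sigma> m = Poly_Mapping.single i n) \<longleftrightarrow>
      (\<exists>i. m = Poly_Mapping.single i n)" if s: "bij \<sigma>" for \<sigma> :: "nat \<Rightarrow> nat" and m :: "nat \<Rightarrow>\<^sub>0 nat"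
  proof
    assume "\<exists>i. Poly_Mapping.map_key \<sigma> m = Poly_Mapping.single i n"
    then obtain i where i: "Poly_Mapping.map_key \<sigma> m = Poly_Mapping.single i n" ..
    have "m = Poly_Mapping.single (\<sigma> i) n"
    proof (rule poly_mapping_eqI)
      fix j
      obtain l where l: "j = \<sigma> l"
        using s by (metis bij_pointE)
      show "expo m j = expo (Poly_Mapping.single (\<sigma> i) n) j"
        using arg_cong[OF i, of "\<lambda>x. expo x l"] s
        by (auto simp: l lookup_map_key_bij lookup_single when_def bij_is_inj inj_eq)
    qed
    then show "\<exists>i. m = Poly_Mapping.single i n" ..
  next
    assume "\<exists>i. m = Poly_Mapping.single i n"
    then obtain i where i: "m = Poly_Mapping.single i n" ..
    obtain l where "i = \<sigma> l"
      using s by (metis bij_pointE)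
    then have "Poly_Mapping.map_key \<sigma> m = Poly_Mapping.single l n"
      using s by (simp add: i map_key_single bij_is_inj)
    then show "\<exists>i. Poly_Mapping.map_key \<sigma> m = Poly_Mapping.single i n" ..
  qed
  then show "permutation_invariant (\<lambda>m. if \<exists>i. m = Poly_Mapping.single i n then 1 else (0::'a))"
    by (simp add: permutation_invariant_def)
qed

text \<open>Complete homogeneous symmetric functions: the sum of all monomials of degree \<open>n\<close>.\<close>

lift_definition sym_h :: "nat \<Rightarrow> 'a::comm_ring_1 symfun" is "\<lambda>n m. if mdeg m = n then 1 else 0"
  by (auto simp: bounded_degree_def permutation_invariant_def mdeg_map_key)


section \<open>Plethysm\<close>

text \<open>
  \<open>pleth \<iota> a\<close> is the plethystic substitution \<open>F \<mapsto> F[A]\<close> with values in a commutative ring, where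
  \<open>\<iota>\<close> embeds the coefficient field into that ring and \<open>a n\<close> is \<open>p\<^sub>n[A]\<close>: the ring homomorphism that
  fixes the coefficients and maps \<open>p\<^sub>n\<close> to \<open>p\<^sub>n[A]\<close>.  It exists and is unique over a field of
  characteristic 0, the power sums then being free generators of the ring of symmetric functions.
\<close>

definition is_pleth :: "('a::comm_ring_1 \<Rightarrow> 'b::comm_ring_1) \<Rightarrow> (nat \<Rightarrow> 'b) \<Rightarrow> ('a symfun \<Rightarrow> 'b) \<Rightarrow> bool"
  where "is_pleth \<iota> a \<phi> \<longleftrightarrow>
    (\<forall>F G. \<phi> (F + G) = \<phi> F + \<phi> G) \<and> (\<forall>F G. \<phi> (F * G) = \<phi> F * \<phi> G) \<and>
    (\<forall>c. \<phi> (sym_const c) = \<iota> c) \<and> (\<forall>n\<ge>1. \<phi> (sym_p n) = a n)"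

definition pleth :: "('a::comm_ring_1 \<Rightarrow> 'b::comm_ring_1) \<Rightarrow> (nat \<Rightarrow> 'b) \<Rightarrow> 'a symfun \<Rightarrow> 'b"
  where "pleth \<iota> a = (THE \<phi>. is_pleth \<iota> a \<phi>)"

definition pleth_Exp ::
    "('a::comm_ring_1 \<Rightarrow> 'b) \<Rightarrow> (nat \<Rightarrow> 'b) \<Rightarrow> 'b::{comm_ring_1,topological_space}"
  where "pleth_Exp \<iota> a = suminf (\<lambda>n. pleth \<iota> a (sym_h n))"


section \<open>The spaces \<open>V\<^sub>k\<close> and the operators\<close>

text \<open>Polynomials in variables \<open>y\<^sub>i\<close> are finitely supported maps from monomials to coefficients.\<close>

type_synonym 'a ypoly = "(nat \<Rightarrow>\<^sub>0 nat) \<Rightarrow>\<^sub>0 'a"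

definition yconst :: "'a::zero \<Rightarrow> 'a ypoly"
  where "yconst c = Poly_Mapping.single 0 c"

definition yvar :: "nat \<Rightarrow> 'a::zero_neq_one ypoly"
  where "yvar i = Poly_Mapping.single (Poly_Mapping.single i 1) 1"

text \<open>Apply \<open>c\<close> to the coefficients and substitute \<open>v i\<close> for \<open>y\<^sub>i\<close>.\<close>

definition ysubst :: "('a::zero \<Rightarrow> 'b::comm_ring_1) \<Rightarrow> (nat \<Rightarrow> 'b) \<Rightarrow> 'a ypoly \<Rightarrow> 'b"
  where "ysubst c v P = (\<Sum>m\<in>Poly_Mapping.keys P. c (Poly_Mapping.lookup P m) *
    (\<Prod>i\<in>Poly_Mapping.keys m. v i ^ expo m i))"

text \<open>The field \<open>\<rat>(q,t)\<close> is the fraction field of \<open>\<rat>[q][t]\<close>; \<open>q\<close> is the variable of the inner polynomials.\<close>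

type_synonym qtfield = "rat poly poly fract"

definition qvar :: qtfield
  where "qvar = Fract [:[:0, 1:]:] 1"

type_synonym V = "qtfield symfun ypoly"

definition Vspace :: "nat \<Rightarrow> V set"
  where "Vspace k = {F. \<forall>m\<in>Poly_Mapping.keys F. Poly_Mapping.keys m \<subseteq> {1..k}}"

definition Vconst :: "qtfield \<Rightarrow> V"
  where "Vconst c = yconst (sym_const c)"

text \<open>Plethystic substitution with values in \<open>V\<close> that acts on the coefficients only.\<close>

definition Vpleth :: "(nat \<Rightarrow> V) \<Rightarrow> V \<Rightarrow> V"
  where "Vpleth a F = ysubst (pleth Vconst a) yvar F"

definition swap_y :: "nat \<Rightarrow> V \<Rightarrow> V"
  where "swap_y i P = ysubst yconst (yvar \<circ> (id(i := Suc i, Suc i := i))) P"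

definition T_op :: "nat \<Rightarrow> V \<Rightarrow> V"
  where "T_op i P = (THE R. (yvar (Suc i) - yvar i) * R =
    (Vconst qvar - 1) * yvar i * P + (yvar (Suc i) - Vconst qvar * yvar i) * swap_y i P)"

definition d_plus :: "nat \<Rightarrow> V \<Rightarrow> V"
  where "d_plus k F = foldr T_op [1..<Suc k]
    (Vpleth (\<lambda>n. yconst (sym_p n) + (Vconst qvar ^ n - 1) * yvar (Suc k) ^ n) F)"

text \<open>
  Products with \<open>Exp[-y\<^sub>k\<^sup>-\<^sup>1 X]\<close> are formed in the ring of formal Laurent series in \<open>u = y\<^sub>k\<^sup>-\<^sup>1\<close> over
  \<^typ>\<open>V\<close>: \<open>to_laurent k\<close> replaces \<open>y\<^sub>k\<close> by \<open>u\<^sup>-\<^sup>1\<close>, and \<open>Exp[-u X]\<close> is a power series in \<open>u\<close> (its defining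
  sum converges in the \<open>u\<close>-adic topology).  The coefficient of \<open>y\<^sub>k\<^sup>-\<^sup>1\<close> is then that of \<open>u\<^sup>1\<close>.
\<close>

definition to_laurent :: "nat \<Rightarrow> V \<Rightarrow> V fls"
  where "to_laurent k P = ysubst (fls_const \<circ> yconst)
    (\<lambda>i. if i = k then fls_X_inv else fls_const (yvar i)) P"

definition Exp_minus_uX :: "V fps"
  where "Exp_minus_uX = pleth_Exp (fps_const \<circ> Vconst) (\<lambda>n. - (fps_X ^ n * fps_const (yconst (sym_p n))))"

definition d_minus :: "nat \<Rightarrow> V \<Rightarrow> V"
  where "d_minus k F = - fls_nth
    (to_laurent k (Vpleth (\<lambda>n. yconst (sym_p n) - (Vconst qvar ^ n - 1) * yvar k ^ n) F)
      * fps_to_fls Exp_minus_uX) 1"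

datatype sign = Plus | Minus

text \<open>
  \<open>apply_signs [\<epsilon>\<^sub>1, \<dots>, \<epsilon>\<^sub>r] k\<close> is the composite operator \<open>d\<^bsub>\<epsilon>\<^sub>1\<^esub> \<dots> d\<^bsub>\<epsilon>\<^sub>r\<^esub>\<close> on \<open>V\<^sub>k\<close>; its values lie in
  \<open>V\<^sub>l\<close> for \<open>l = level [\<epsilon>\<^sub>1, \<dots>, \<epsilon>\<^sub>r] k\<close>, provided \<open>d\<^sub>-\<close> is never applied to an element of \<open>V\<^sub>0\<close>.
\<close>

fun level :: "sign list \<Rightarrow> nat \<Rightarrow> nat" where
  "level [] k = k"
| "level (Plus # es) k = Suc (level es k)"
| "level (Minus # es) k = level es k - 1"

fun apply_signs :: "sign list \<Rightarrow> nat \<Rightarrow> V \<Rightarrow> V" where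
  "apply_signs [] k f = f"
| "apply_signs (Plus # es) k f = d_plus (level es k) (apply_signs es k f)"
| "apply_signs (Minus # es) k f = d_minus (level es k) (apply_signs es k f)"


section \<open>Dyck paths\<close>

datatype step = North | East

text \<open>After \<open>m\<close> steps the path is at the point whose coordinates are the numbers of East and North
  steps among the first \<open>m\<close> steps.\<close>

definition xpos :: "step list \<Rightarrow> nat \<Rightarrow> nat"
  where "xpos \<pi> m = count_list (take m \<pi>) East"

definition ypos :: "step list \<Rightarrow> nat \<Rightarrow> nat"
  where "ypos \<pi> m = count_list (take m \<pi>) North"

definition dyck_path :: "nat \<Rightarrow> step list \<Rightarrow> bool"
  where "dyck_path N \<pi> \<longleftrightarrow> xpos \<pi> (length \<pi>) = N \<and> ypos \<pi> (length \<pi>) = N \<and>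
    (\<forall>m\<le>length \<pi>. xpos \<pi> m \<le> ypos \<pi> m)"

text \<open>The cell with top right corner \<open>(i,j)\<close> lies under the path if the East step from abscissa
  \<open>i - 1\<close> to abscissa \<open>i\<close> is at height at least \<open>j\<close>.\<close>

definition cell_under :: "step list \<Rightarrow> nat \<Rightarrow> nat \<Rightarrow> bool"
  where "cell_under \<pi> i j \<longleftrightarrow>
    (\<exists>m<length \<pi>. \<pi> ! m = East \<and> xpos \<pi> (Suc m) = i \<and> j \<le> ypos \<pi> m)"

definition area :: "step list \<Rightarrow> nat"
  where "area \<pi> = card {(i, j). i < j \<and> cell_under \<pi> i j}"

fun step_sign :: "step \<Rightarrow> sign" where
  "step_sign East = Plus"
| "step_sign North = Minus"

end

theory Submission
  imports Defs "HOL-Combinatorics.Permutations"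
begin

text \<open>
  Let \<open>E\<^sub>k\<close> be the ring homomorphism \<open>F \<mapsto> F[-q\<^sup>k]\<close>, \<open>y\<^sub>i \<mapsto> q\<^sup>i\<^sup>-\<^sup>1\<close> on \<open>V\<^sub>k\<close>.  Since \<open>T\<^sub>i\<close> is invisible at
  \<open>y\<^sub>i\<^sub>+\<^sub>1 = q y\<^sub>i\<close>, one has \<open>E\<^sub>k\<^sub>+\<^sub>1 (d\<^sub>+ F) = E\<^sub>k F\<close>; since \<open>Exp[-u X]\<close> becomes the geometric series of ratio
  \<open>q\<^sup>k\<^sup>-\<^sup>1 u\<close> at \<open>X = -q\<^sup>k\<^sup>-\<^sup>1\<close>, extracting the coefficient of \<open>y\<^sub>k\<^sup>-\<^sup>1\<close> substitutes \<open>y\<^sub>k = q\<^sup>k\<^sup>-\<^sup>1\<close>, and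
  \<open>E\<^sub>k\<^sub>-\<^sub>1 (d\<^sub>- F) = -q\<^sup>k\<^sup>-\<^sup>1 E\<^sub>k F\<close>; the plethystic substitutions involved are compared on generators.
  The North steps thus contribute \<open>(-1)\<^sup>N\<close> and a power of \<open>q\<close> whose exponent is the number of cells under
  the path, counted row by row.  That plethystic substitutions exist rests on the power sums being free
  generators of the ring of symmetric functions.
\<close>

section \<open>Homomorphisms of commutative rings\<close>

locale crhom =
  fixes h :: "'a::comm_ring_1 \<Rightarrow> 'b::comm_ring_1"
  assumes add: "h (x + y) = h x + h y"
    and mult: "h (x * y) = h x * h y"
    and one: "h 1 = 1"
begin

lemma zero: "h 0 = 0"
  using add[of 0 0] by simp

lemma uminus: "h (- x) = - h x"
  using add[of x "- x"] zero by (simp add: eq_neg_iff_add_eq_0 add.commute)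

lemma diff: "h (x - y) = h x - h y"
  using add[of x "- y"] by (simp add: uminus)

lemma power: "h (x ^ n) = h x ^ n"
  by (induction n) (simp_all add: one mult)

lemma sum: "h (sum f A) = (\<Sum>i\<in>A. h (f i))"
  by (induction A rule: infinite_finite_induct) (simp_all add: zero add)

lemmas simps = add mult one zero uminus diff power

end

lemma crhom_id: "crhom id"
  by unfold_locales auto

lemma crhom_comp: "crhom g \<Longrightarrow> crhom f \<Longrightarrow> crhom (g \<circ> f)"
  by (simp add: crhom_def)

section \<open>Polynomials and substitutions\<close>

definition ymon :: "(nat \<Rightarrow> 'b::comm_ring_1) \<Rightarrow> (nat \<Rightarrow>\<^sub>0 nat) \<Rightarrow> 'b"
  where "ymon v m = (\<Prod>i\<in>Poly_Mapping.keys m. v i ^ expo m i)"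

lemma ymon_superset:
  assumes "finite A" "Poly_Mapping.keys m \<subseteq> A"
  shows "ymon v m = (\<Prod>i\<in>A. v i ^ expo m i)"
  unfolding ymon_def using assms by (intro prod.mono_neutral_left) (auto simp: in_keys_iff)

lemma ymon_0 [simp]: "ymon v 0 = 1"
  by (simp add: ymon_def)

lemma ymon_single [simp]: "ymon v (Poly_Mapping.single i n) = v i ^ n"
  by (simp add: ymon_superset[of "{i}"])

lemma ymon_add: "ymon v (a + b) = ymon v a * ymon v b"
proof -
  let ?A = "Poly_Mapping.keys a \<union> Poly_Mapping.keys b"
  have "ymon v (a + b) = (\<Prod>i\<in>?A. v i ^ expo (a + b) i)"
    by (rule ymon_superset) (use Poly_Mapping.keys_add[of a b] in auto)
  also have "\<dots> = ymon v a * ymon v b"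
    by (simp add: lookup_add power_add prod.distrib ymon_superset[of ?A a] ymon_superset[of ?A b])
  finally show ?thesis .
qed

text \<open>Turns a basis monomial into a product of variables, so that constants and variables
  generate all polynomials.\<close>

lemma ymon_yvar: "ymon yvar m = (Poly_Mapping.single m 1 :: 'a::comm_ring_1 ypoly)"
proof -
  have pow: "(yvar i :: 'a ypoly) ^ n = Poly_Mapping.single (Poly_Mapping.single i n) 1" for i n
    by (induction n) (simp_all add: yvar_def mult_single single_add[symmetric])
  have "(\<Prod>i\<in>A. (yvar i :: 'a ypoly) ^ expo m i)
      = Poly_Mapping.single (\<Sum>i\<in>A. Poly_Mapping.single i (expo m i)) 1" if "finite A" for A
    using that by (induction A) (simp_all add: pow mult_single)
  moreover have "(\<Sum>i\<in>Poly_Mapping.keys m. Poly_Mapping.single i (expo m i)) = m"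
    by (rule poly_mapping_eqI) (simp add: lookup_sum lookup_single when_def in_keys_iff)
  ultimately show ?thesis
    by (simp add: ymon_def)
qed

lemma ysubst_superset:
  assumes "c 0 = 0" "finite A" "Poly_Mapping.keys P \<subseteq> A"
  shows "ysubst c v P = (\<Sum>m\<in>A. c (Poly_Mapping.lookup P m) * ymon v m)"
  unfolding ysubst_def ymon_def using assms
  by (intro sum.mono_neutral_left) (auto simp: in_keys_iff)

lemma ysubst_single:
  assumes "c 0 = 0"
  shows "ysubst c v (Poly_Mapping.single m a) = c a * ymon v m"
  by (simp add: ysubst_superset[of c "{m}"] assms)

lemma ypoly_sum_single:
  "P = (\<Sum>m\<in>Poly_Mapping.keys P. Poly_Mapping.single m (Poly_Mapping.lookup P m))"
  by (rule poly_mapping_eqI) (simp add: lookup_sum lookup_single when_def in_keys_iff)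

lemma ypoly_single: "Poly_Mapping.single m a = yconst a * ymon yvar m"
  by (simp add: ymon_yvar yconst_def mult_single)

text \<open>The set \<open>A\<close> confines the variables: one rule serves both arbitrary
  polynomials (\<open>A = UNIV\<close>) and \<open>Vspace k\<close>
  (\<open>A = {1..k}\<close>).\<close>

lemma ypoly_induct_on [consumes 1, case_names const var add mult]:
  fixes P :: "'a::comm_ring_1 ypoly"
  assumes keys: "\<And>m. m \<in> Poly_Mapping.keys P \<Longrightarrow> Poly_Mapping.keys m \<subseteq> A"
    and const: "\<And>a. Q (yconst a)"
    and var: "\<And>i. i \<in> A \<Longrightarrow> Q (yvar i)"
    and add: "\<And>F G. Q F \<Longrightarrow> Q G \<Longrightarrow> Q (F + G)"
    and mult: "\<And>F G. Q F \<Longrightarrow> Q G \<Longrightarrow> Q (F * G)"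
  shows "Q P"
proof -
  have one: "Q 1" and zero: "Q 0"
    using const[of 1] const[of 0] by (simp_all add: yconst_def)
  have pow: "Q (yvar i ^ n)" if "i \<in> A" for i n
    by (induction n) (use that in \<open>auto intro: one mult var\<close>)
  have single: "Q (Poly_Mapping.single m a)" if "m \<in> Poly_Mapping.keys P" for m a
  proof -
    have "Q (\<Prod>i\<in>B. yvar i ^ expo m i)" if "finite B" "B \<subseteq> A" for B
      using that by (induction B) (auto intro: one mult pow)
    then have "Q (ymon yvar m)"
      using keys[OF that] by (auto simp: ymon_def)
    then show ?thesis
      by (simp only: ypoly_single const mult)
  qed
  have "Q (\<Sum>m\<in>B. Poly_Mapping.single m (Poly_Mapping.lookup P m))"
    if "finite B" "B \<subseteq> Poly_Mapping.keys P" for B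
    using that by (induction B) (auto intro: zero add single)
  then show ?thesis
    by (subst ypoly_sum_single) auto
qed

lemma ypoly_induct [case_names const var add mult]:
  fixes P :: "'a::comm_ring_1 ypoly"
  assumes "\<And>a. Q (yconst a)" "\<And>i. Q (yvar i)"
    and "\<And>F G. Q F \<Longrightarrow> Q G \<Longrightarrow> Q (F + G)" "\<And>F G. Q F \<Longrightarrow> Q G \<Longrightarrow> Q (F * G)"
  shows "Q P"
  by (rule ypoly_induct_on[where A = UNIV]) (use assms in auto)

lemma crhom_yconst: "crhom yconst"
  by unfold_locales (simp_all add: yconst_def single_add mult_single)

context crhom
begin

lemma ysubst_yconst: "ysubst h v (yconst a) = h a"
  by (simp add: yconst_def ysubst_single zero)

lemma ysubst_yvar: "ysubst h v (yvar i) = v i"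
  by (simp add: yvar_def ysubst_single zero one)

lemma ysubst_add: "ysubst h v (P + Q) = ysubst h v P + ysubst h v Q"
proof -
  let ?A = "Poly_Mapping.keys P \<union> Poly_Mapping.keys Q"
  have "ysubst h v (P + Q) = (\<Sum>m\<in>?A. h (Poly_Mapping.lookup (P + Q) m) * ymon v m)"
    by (rule ysubst_superset) (use Poly_Mapping.keys_add[of P Q] zero in auto)
  also have "\<dots> = ysubst h v P + ysubst h v Q"
    by (simp add: lookup_add add distrib_right sum.distrib
        ysubst_superset[of h ?A P] ysubst_superset[of h ?A Q] zero)
  finally show ?thesis .
qed

lemma ysubst_sum: "ysubst h v (sum f A) = (\<Sum>i\<in>A. ysubst h v (f i))"
  by (induction A rule: infinite_finite_induct)
    (simp_all add: ysubst_add ysubst_superset[of h "{}" 0] zero)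

lemma crhom_ysubst: "crhom (ysubst h v)"
proof
  fix P Q :: "'a ypoly"
  show "ysubst h v (P + Q) = ysubst h v P + ysubst h v Q"
    by (rule ysubst_add)
  show "ysubst h v 1 = 1"
    using ysubst_yconst[of v 1] by (simp add: yconst_def one)
  \<comment> \<open>With both factors expanded into monomials, additivity leaves products of two
    monomials, where \<open>ymon_add\<close> applies.\<close>
  let ?p = "\<lambda>m. Poly_Mapping.single m (Poly_Mapping.lookup P m)"
  let ?q = "\<lambda>m. Poly_Mapping.single m (Poly_Mapping.lookup Q m)"
  have "ysubst h v (sum ?p (Poly_Mapping.keys P) * sum ?q (Poly_Mapping.keys Q)) =
      ysubst h v (sum ?p (Poly_Mapping.keys P)) * ysubst h v (sum ?q (Poly_Mapping.keys Q))"
    by (simp add: sum_product ysubst_sum mult_single ysubst_single zero mult ymon_add mult_ac)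
  then show "ysubst h v (P * Q) = ysubst h v P * ysubst h v Q"
    by (simp only: ypoly_sum_single[symmetric])
qed

end

lemma crhom_ypoly_eqI:
  fixes f g :: "'a::comm_ring_1 ypoly \<Rightarrow> 'b::comm_ring_1"
  assumes "crhom f" "crhom g" "\<And>a. f (yconst a) = g (yconst a)" "\<And>i. f (yvar i) = g (yvar i)"
  shows "f P = g P"
proof -
  interpret f: crhom f by fact
  interpret g: crhom g by fact
  show ?thesis
    by (induction P rule: ypoly_induct) (simp_all add: assms f.simps g.simps)
qed

section \<open>Power sums generate the symmetric functions freely\<close>

lemma sym_coeff_0 [simp]: "sym_coeff 0 m = 0"
  by (rule zero_symfun.rep_eq[THEN fun_cong])

lemma sym_coeff_add: "sym_coeff (F + G) m = sym_coeff F m + sym_coeff G m"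
  by (rule plus_symfun.rep_eq[THEN fun_cong])

lemma sym_coeff_sum: "sym_coeff (sum f A) m = (\<Sum>i\<in>A. sym_coeff (f i) m)"
  by (induction A rule: infinite_finite_induct) (simp_all add: sym_coeff_add)

lemma sym_coeff_diff: "sym_coeff (F - G) m = sym_coeff F m - sym_coeff G m"
  by (simp add: minus_symfun_def sym_coeff_add uminus_symfun.rep_eq del: add_uminus_conv_diff)

lemma symfun_eqI: "(\<And>m. sym_coeff F m = sym_coeff G m) \<Longrightarrow> F = G"
  by (rule sym_coeff_inject[THEN iffD1]) (rule ext)

lemma sym_coeff_const_mult: "sym_coeff (sym_const c * F) m = c * sym_coeff F m"
proof -
  have "sym_coeff (sym_const c * F) m
      = (\<Sum>(a, b) | a + b = m. if a = 0 then c * sym_coeff F b else 0)"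
    unfolding times_symfun.rep_eq conv_def sym_const.rep_eq by (rule sum.cong) auto
  also have "\<dots> = (\<Sum>(a, b)\<in>{(0 :: nat \<Rightarrow>\<^sub>0 nat, m)}. if a = 0 then c * sym_coeff F b else 0)"
    by (rule sum.mono_neutral_right[OF finite_splits]) (auto split: if_splits)
  finally show ?thesis
    by simp
qed

lemma crhom_sym_const: "crhom sym_const"
proof
  fix x y :: 'a
  show "sym_const (x + y) = sym_const x + sym_const y"
    by (rule symfun_eqI) (simp add: sym_coeff_add sym_const.rep_eq)
  show "sym_const (x * y) = sym_const x * sym_const y"
    by (rule symfun_eqI) (simp add: sym_coeff_const_mult sym_const.rep_eq)
  show "sym_const 1 = (1 :: 'a symfun)"
    by (rule symfun_eqI) (simp add: one_symfun.rep_eq sym_const.rep_eq)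
qed

section \<open>Shapes of monomials and products of power sums\<close>

lemma mdeg_single [simp]: "mdeg (Poly_Mapping.single i n) = n"
  by (simp add: mdeg_superset[of "{i}"])

text \<open>Under the encoding of partitions by multiplicities, the induction step adds a single
  part.\<close>

lemma poly_mapping_nat_induct [case_names zero add]:
  fixes c :: "nat \<Rightarrow>\<^sub>0 nat"
  assumes "Q 0" and "\<And>c i. Q c \<Longrightarrow> Q (c + Poly_Mapping.single i 1)"
  shows "Q c"
proof (induction "mdeg c" arbitrary: c)
  case 0
  then have "c = 0"
    using expo_le_mdeg[of c] by (intro poly_mapping_eqI) simp
  then show ?case
    using assms(1) by simp
next
  case (Suc n)
  then have "c \<noteq> 0"
    by auto
  then obtain i where "i \<in> Poly_Mapping.keys c"
    using keys_eq_empty by blast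
  then have i: "expo c i \<noteq> 0"
    by (simp add: in_keys_iff)
  define c' where "c' = c - Poly_Mapping.single i 1"
  have c: "c = c' + Poly_Mapping.single i 1"
    using i by (intro poly_mapping_eqI) (auto simp: c'_def lookup_add lookup_minus lookup_single when_def)
  with Suc.hyps(2) have "n = mdeg c'"
    by (simp add: mdeg_add)
  then have "Q c'"
    by (rule Suc.hyps(1))
  then show ?case
    unfolding c by (rule assms(2))
qed

text \<open>The shape of the monomial \<open>x\<^sup>m\<close> is the partition formed by its nonzero exponents.  A
  partition is encoded by its multiplicities: \<open>expo c i\<close> is the number of parts equal to
  \<open>i + 1\<close>, so that \<open>mdeg c\<close> is the number of parts.\<close>

definition shape :: "(nat \<Rightarrow>\<^sub>0 nat) \<Rightarrow> (nat \<Rightarrow>\<^sub>0 nat)"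
  where "shape m = (\<Sum>i\<in>Poly_Mapping.keys m. Poly_Mapping.single (expo m i - 1) 1)"

definition power_sum_monomial :: "(nat \<Rightarrow>\<^sub>0 nat) \<Rightarrow> 'a::comm_ring_1 symfun"
  where "power_sum_monomial = ymon (\<lambda>i. sym_p (Suc i))"

lemma mdeg_sum: "mdeg (sum f A) = (\<Sum>i\<in>A. mdeg (f i))"
  by (induction A rule: infinite_finite_induct) (simp_all add: mdeg_add)

lemma mdeg_shape: "mdeg (shape m) = card (Poly_Mapping.keys m)"
  by (simp add: shape_def mdeg_sum)

lemma shape_0 [simp]: "shape 0 = 0"
  by (simp add: shape_def)

lemma keys_add_nat: "Poly_Mapping.keys (a + b :: 'i \<Rightarrow>\<^sub>0 nat) = Poly_Mapping.keys a \<union> Poly_Mapping.keys b"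
  by (auto simp: in_keys_iff lookup_add)

text \<open>A fresh variable contributes a new part \<open>n + 1\<close>, stored at index
  \<open>n\<close>; a variable already present would enlarge an old part instead.\<close>

lemma shape_add_single:
  assumes "i \<notin> Poly_Mapping.keys m"
  shows "shape (m + Poly_Mapping.single i (Suc n)) = shape m + Poly_Mapping.single n 1"
proof -
  have i: "expo m i = 0"
    using assms by (simp add: in_keys_iff)
  have "shape (m + Poly_Mapping.single i (Suc n)) =
     (\<Sum>j\<in>insert i (Poly_Mapping.keys m). Poly_Mapping.single (expo (m + Poly_Mapping.single i (Suc n)) j - 1) 1)"
    by (simp add: shape_def keys_add_nat)
  also have "\<dots> = Poly_Mapping.single n 1 + (\<Sum>j\<in>Poly_Mapping.keys m. Poly_Mapping.single (expo m j - 1) 1)"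
    using assms i by (subst sum.insert)
      (auto simp: lookup_add lookup_single when_def intro!: arg_cong2[where f = "(+)"] sum.cong)
  finally show ?thesis
    by (simp add: shape_def add.commute)
qed

lemma ex_shape: "\<exists>m. shape m = c"
proof (induction c rule: poly_mapping_nat_induct)
  case zero
  then show ?case
    by (intro exI[of _ 0]) simp
next
  case (add c i)
  then obtain m where m: "shape m = c" ..
  obtain j where "j \<notin> Poly_Mapping.keys m"
    using ex_new_if_finite[OF infinite_UNIV_nat finite_keys] by blast
  then show ?case
    using shape_add_single[of j m i] m by auto
qed

text \<open>Each term x_i^n of the power sum that divides the monomial contributes once. The bound
  \<open>n \<le> expo m i\<close> makes the truncated subtraction a true quotient, and
  \<open>n > 0\<close> makes the terms x_i^n distinct.\<close>

lemma sym_coeff_sym_p_mult: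
  assumes "n > 0"
  shows "sym_coeff (sym_p n * F) m =
    (\<Sum>i | n \<le> expo m i. sym_coeff F (m - Poly_Mapping.single i n))"
proof -
  let ?S = "{i. n \<le> expo m i}"
  have split: "m = Poly_Mapping.single i n + (m - Poly_Mapping.single i n)" if "i \<in> ?S" for i
    using that by (intro poly_mapping_eqI) (auto simp: lookup_add lookup_minus lookup_single when_def)
  have le: "i \<in> ?S" if "Poly_Mapping.single i n + b = m" for i b
    using that by (auto simp: lookup_add)
  have inj: "inj_on (\<lambda>i. (Poly_Mapping.single i n, m - Poly_Mapping.single i n)) ?S"
  proof (rule inj_onI)
    fix i j
    assume "(Poly_Mapping.single i n, m - Poly_Mapping.single i n) =
      (Poly_Mapping.single j n, m - Poly_Mapping.single j n)"
    then have "expo (Poly_Mapping.single i n) i = expo (Poly_Mapping.single j n) i"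
      by simp
    then show "i = j"
      using assms by (auto simp: lookup_single when_def split: if_splits)
  qed
  have "sym_coeff (sym_p n * F) m =
      (\<Sum>(a, b) | a + b = m. (if \<exists>i. a = Poly_Mapping.single i n then 1 else 0) * sym_coeff F b)"
    by (simp add: times_symfun.rep_eq conv_def sym_p.rep_eq)
  also have "\<dots> = (\<Sum>(a, b)\<in>(\<lambda>i. (Poly_Mapping.single i n, m - Poly_Mapping.single i n)) ` ?S.
      sym_coeff F b)"
  proof (rule sum.mono_neutral_cong_right[OF finite_splits])
    show "(\<lambda>i. (Poly_Mapping.single i n, m - Poly_Mapping.single i n)) ` ?S \<subseteq> {(a, b). a + b = m}"
      using split by auto
    show "\<forall>i\<in>{(a, b). a + b = m} - (\<lambda>i. (Poly_Mapping.single i n, m - Poly_Mapping.single i n)) ` ?S.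
       (case i of (a, b) \<Rightarrow> (if \<exists>i. a = Poly_Mapping.single i n then 1 else 0) * sym_coeff F b) = 0"
      using le by (force simp: image_iff)
  qed auto
  also have "\<dots> = (\<Sum>i\<in>?S. sym_coeff F (m - Poly_Mapping.single i n))"
    by (subst sum.reindex[OF inj]) simp
  finally show ?thesis .
qed

lemma power_sum_monomial_0: "power_sum_monomial 0 = 1"
  by (simp add: power_sum_monomial_def)

lemma power_sum_monomial_add_single:
  "power_sum_monomial (c + Poly_Mapping.single n 1) = sym_p (Suc n) * power_sum_monomial c"
  by (simp add: power_sum_monomial_def ymon_add mult.commute)

text \<open>Triangularity of the expansion of \<open>p\<^sub>\<lambda>\<close> in monomial symmetric functions, with respect to the
  number of parts.\<close>

lemma sym_coeff_power_sum_monomial_nonzero: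
  assumes "sym_coeff (power_sum_monomial c) m \<noteq> 0"
  shows "mdeg (shape m) < mdeg c \<or> shape m = c"
  using assms
proof (induction c arbitrary: m rule: poly_mapping_nat_induct)
  case zero
  then show ?case
    by (auto simp: power_sum_monomial_0 one_symfun.rep_eq split: if_splits)
next
  case (add c n)
  then obtain i where i: "Suc n \<le> expo m i"
    and nz: "sym_coeff (power_sum_monomial c :: 'a symfun) (m - Poly_Mapping.single i (Suc n)) \<noteq> 0"
    unfolding power_sum_monomial_add_single sym_coeff_sym_p_mult[OF zero_less_Suc]
    by (metis (mono_tags, lifting) mem_Collect_eq sum.neutral)
  define m' where "m' = m - Poly_Mapping.single i (Suc n)"
  have m: "m = m' + Poly_Mapping.single i (Suc n)"
    using i by (intro poly_mapping_eqI) (auto simp: m'_def lookup_add lookup_minus lookup_single when_def)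
  have IH: "mdeg (shape m') < mdeg c \<or> shape m' = c"
    using add.IH nz by (simp add: m'_def)
  show ?case
  \<comment> \<open>Multiplication by x_i^(n+1) either enlarges an existing part, leaving the number
    of parts below \<open>mdeg c + 1\<close>, or creates the new part \<open>n + 1\<close>.\<close>
  proof (cases "i \<in> Poly_Mapping.keys m'")
    case True
    then have "Poly_Mapping.keys m = Poly_Mapping.keys m'"
      by (auto simp: m keys_add_nat)
    then have "mdeg (shape m) = mdeg (shape m')"
      by (simp add: mdeg_shape)
    then show ?thesis
      using IH by (auto simp: mdeg_add)
  next
    case False
    then show ?thesis
      using IH by (auto simp: m shape_add_single mdeg_add)
  qed
qed

text \<open>The coefficients are natural numbers, so contributions cannot cancel and one positive
  contribution on the diagonal suffices; characteristic 0 then gives nonvanishing.\<close>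

lemma sym_coeff_power_sum_monomial_of_nat:
  "\<exists>k. sym_coeff (power_sum_monomial c :: 'a::comm_ring_1 symfun) m = of_nat k \<and> (shape m = c \<longrightarrow> k > 0)"
proof (induction c arbitrary: m rule: poly_mapping_nat_induct)
  case zero
  have "m = 0" if "shape m = 0"
    using mdeg_shape[of m] that by simp
  then show ?case
    by (intro exI[of _ "if m = 0 then 1 else 0"]) (auto simp: power_sum_monomial_0 one_symfun.rep_eq)
next
  case (add c n)
  define k where
    "k m = (SOME k. sym_coeff (power_sum_monomial c :: 'a symfun) m = of_nat k \<and> (shape m = c \<longrightarrow> k > 0))" for m
  have k: "sym_coeff (power_sum_monomial c :: 'a symfun) m = of_nat (k m)"
      "shape m = c \<Longrightarrow> k m > 0" for m
    using someI_ex[OF add[of m]] by (auto simp: k_def)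
  let ?S = "{i. Suc n \<le> expo m i}"
  have fin: "finite ?S"
    by (rule finite_subset[of _ "Poly_Mapping.keys m"]) (auto simp: in_keys_iff)
  have "(\<Sum>i\<in>?S. k (m - Poly_Mapping.single i (Suc n))) > 0"
    if sh: "shape m = c + Poly_Mapping.single n 1"
  proof -
    \<comment> \<open>The part \<open>n + 1\<close> occurs in the shape of \<open>m\<close>, so some
      variable has exactly this exponent; deleting it leaves shape \<open>c\<close>.\<close>
    have "expo (shape m) n \<noteq> 0"
      by (simp add: sh lookup_add)
    then have "(\<Sum>i\<in>Poly_Mapping.keys m. if expo m i - 1 = n then 1 else (0::nat)) \<noteq> 0"
      by (simp only: shape_def lookup_sum lookup_single when_def not_False_eq_True)
    then have "\<not> (\<forall>i\<in>Poly_Mapping.keys m. (if expo m i - 1 = n then 1 else (0::nat)) = 0)"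
      by (simp only: sum_eq_0_iff[OF finite_keys] not_False_eq_True)
    then obtain i where i: "i \<in> Poly_Mapping.keys m" "expo m i - 1 = n"
      by (metis (full_types))
    then have n: "expo m i = Suc n"
      by (auto simp: in_keys_iff)
    define m' where "m' = m - Poly_Mapping.single i (Suc n)"
    have m: "m = m' + Poly_Mapping.single i (Suc n)"
      using n by (intro poly_mapping_eqI) (auto simp: m'_def lookup_add lookup_minus lookup_single when_def)
    have "i \<notin> Poly_Mapping.keys m'"
      using n by (simp add: m'_def in_keys_iff lookup_minus)
    then have "shape m' = c"
      using sh by (simp add: m shape_add_single)
    then have "k m' > 0"
      by (rule k(2))
    then show ?thesis
      using fin n by (intro sum_pos2[of _ i]) (auto simp: m'_def)
  qed
  then show ?case
    unfolding power_sum_monomial_add_single sym_coeff_sym_p_mult[OF zero_less_Suc] k(1)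
    by (intro exI[of _ "\<Sum>i\<in>?S. k (m - Poly_Mapping.single i (Suc n))"]) simp
qed

lemma sym_coeff_power_sum_monomial_shape:
  "sym_coeff (power_sum_monomial (shape m) :: 'a::field_char_0 symfun) m \<noteq> 0"
  using sym_coeff_power_sum_monomial_of_nat[of "shape m" m, where ?'a = 'a] by auto

text \<open>Monomials of equal shape have the same multiset of exponents, hence differ by a
  permutation of the variables.\<close>

lemma sym_coeff_eq_if_shape_eq:
  assumes "shape m = shape m'"
  shows "sym_coeff F m = sym_coeff F m'"
proof -
  let ?A = "Poly_Mapping.keys m \<union> Poly_Mapping.keys m'"
  have cnt: "card {i \<in> Poly_Mapping.keys u. expo u i = Suc n} = expo (shape u) n" for u :: "nat \<Rightarrow>\<^sub>0 nat" and n
  proof -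
    have "expo (shape u) n = (\<Sum>i\<in>Poly_Mapping.keys u. if expo u i = Suc n then 1 else 0)"
      unfolding shape_def lookup_sum
      by (rule sum.cong) (auto simp: lookup_single when_def in_keys_iff)
    then show ?thesis
      by (simp add: sum.If_cases Int_def)
  qed
  have Suc: "card {i \<in> ?A. expo m i = Suc n} = card {i \<in> ?A. expo m' i = Suc n}" for n
  proof -
    have "{i \<in> ?A. expo u i = Suc n} = {i \<in> Poly_Mapping.keys u. expo u i = Suc n}"
      if "u = m \<or> u = m'" for u
      using that by (auto simp: in_keys_iff)
    then show ?thesis
      using cnt[of m n] cnt[of m' n] assms by simp
  qed
  \<comment> \<open>A shape does not record zero exponents; their number in \<open>?A\<close> is
    recovered from the number of parts.\<close>
  have "card (Poly_Mapping.keys m) = card (Poly_Mapping.keys m')"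
    using assms mdeg_shape by metis
  then have "card (?A - Poly_Mapping.keys m) = card (?A - Poly_Mapping.keys m')"
    by (simp add: card_Diff_subset)
  moreover have "{i \<in> ?A. expo u i = 0} = ?A - Poly_Mapping.keys u" for u
    by (auto simp: in_keys_iff)
  ultimately have zero: "card {i \<in> ?A. expo m i = 0} = card {i \<in> ?A. expo m' i = 0}"
    by simp
  have "card {i \<in> ?A. expo m i = n} = card {i \<in> ?A. expo m' i = n}" for n
    by (cases n) (use zero Suc in auto)
  then have "image_mset (expo m) (mset_set ?A) = image_mset (expo m') (mset_set ?A)"
    by (intro multiset_eqI) (simp add: count_image_mset_eq_card_vimage)
  then obtain \<sigma> where \<sigma>: "\<sigma> permutes ?A" "\<forall>i\<in>?A. expo m i = expo m' (\<sigma> i)"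
    using image_mset_eq_implies_permutes[of ?A "expo m" "expo m'"] by auto
  have "expo m i = expo m' (\<sigma> i)" for i
  proof (cases "i \<in> ?A")
    case True
    then show ?thesis
      using \<sigma>(2) by blast
  next
    case False
    then show ?thesis
      using permutes_not_in[OF \<sigma>(1) False] by (simp add: in_keys_iff)
  qed
  moreover have bij: "bij \<sigma>"
    using \<sigma>(1) by (rule permutes_bij)
  ultimately have "m = Poly_Mapping.map_key \<sigma> m'"
    by (intro poly_mapping_eqI) (simp add: lookup_map_key_bij)
  then show ?thesis
    using sym_coeff[of F] bij by (simp add: permutation_invariant_def)
qed

text \<open>Variable \<open>i\<close> stands for the power sum of degree \<open>i + 1\<close>, so
  exponent vectors are partitions in the encoding of \<open>shape\<close>. Bijectivity of this map
  says that the power sums are free generators.\<close>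

definition power_sum_poly :: "'a::comm_ring_1 ypoly \<Rightarrow> 'a symfun"
  where "power_sum_poly = ysubst sym_const (\<lambda>i. sym_p (Suc i))"

lemma crhom_power_sum_poly: "crhom power_sum_poly"
  unfolding power_sum_poly_def by (rule crhom.crhom_ysubst[OF crhom_sym_const])

lemma power_sum_poly_eq:
  "power_sum_poly P =
    (\<Sum>c\<in>Poly_Mapping.keys P. sym_const (Poly_Mapping.lookup P c) * power_sum_monomial c)"
  unfolding power_sum_poly_def power_sum_monomial_def
  by (rule ysubst_superset) (simp_all add: crhom.zero[OF crhom_sym_const])

lemma power_sum_poly_single:
  "power_sum_poly (Poly_Mapping.single c a) = sym_const a * power_sum_monomial c"
  unfolding power_sum_poly_def power_sum_monomial_def
  by (rule ysubst_single[of sym_const, OF crhom.zero[OF crhom_sym_const]])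

text \<open>Among the terms of a nonzero \<open>P\<close>, one with the most parts is chosen. At a
  monomial of its shape, triangularity kills all other terms and leaves a nonzero diagonal
  coefficient.\<close>

lemma inj_power_sum_poly: "inj (power_sum_poly :: 'a::field_char_0 ypoly \<Rightarrow> 'a symfun)"
proof -
  interpret crhom "power_sum_poly :: 'a ypoly \<Rightarrow> 'a symfun"
    by (rule crhom_power_sum_poly)
  have "P = 0" if P: "power_sum_poly P = 0" for P :: "'a ypoly"
  proof (rule ccontr)
    assume "P \<noteq> 0"
    then have "Poly_Mapping.keys P \<noteq> {}"
      by simp
    then have "Max (mdeg ` Poly_Mapping.keys P) \<in> mdeg ` Poly_Mapping.keys P"
      by (intro Max_in) auto
    then obtain c where c: "c \<in> Poly_Mapping.keys P"
      and "mdeg c = Max (mdeg ` Poly_Mapping.keys P)"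
      by auto
    then have max: "mdeg c' \<le> mdeg c" if "c' \<in> Poly_Mapping.keys P" for c'
      using that by simp
    obtain m where m: "shape m = c"
      using ex_shape by blast
    have "sym_coeff (power_sum_poly P) m =
        (\<Sum>c'\<in>Poly_Mapping.keys P. Poly_Mapping.lookup P c' * sym_coeff (power_sum_monomial c') m)"
      by (simp add: power_sum_poly_eq sym_coeff_sum sym_coeff_const_mult)
    also have "\<dots> = (\<Sum>c'\<in>{c}. Poly_Mapping.lookup P c' * sym_coeff (power_sum_monomial c') m)"
    proof (rule sum.mono_neutral_right)
      show "\<forall>c'\<in>Poly_Mapping.keys P - {c}.
          Poly_Mapping.lookup P c' * sym_coeff (power_sum_monomial c') m = 0"
        using sym_coeff_power_sum_monomial_nonzero[where ?'a = 'a and m = m] max m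
        by (metis Diff_iff insertI1 leD mult_zero_right)
    qed (use c in auto)
    finally have "Poly_Mapping.lookup P c * sym_coeff (power_sum_monomial c) m = 0"
      by (simp add: P zero_symfun.rep_eq)
    then show False
      using c sym_coeff_power_sum_monomial_shape[of m, where ?'a = 'a] by (simp add: m in_keys_iff)
  qed
  then show ?thesis
    by (intro injI) (metis diff right_minus_eq)
qed

lemma card_keys_le_mdeg: "card (Poly_Mapping.keys (m :: nat \<Rightarrow>\<^sub>0 nat)) \<le> mdeg m"
proof -
  have "(\<Sum>i\<in>Poly_Mapping.keys m. 1) \<le> mdeg m"
    unfolding mdeg_def by (rule sum_mono) (auto simp: in_keys_iff)
  then show ?thesis
    by simp
qed

text \<open>The degree bound limits both the size of the parts and their multiplicities, although
  infinitely many monomials may occur.\<close>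

lemma finite_shapes: "finite {shape m | m. sym_coeff F m \<noteq> 0}"
proof -
  obtain d where d: "\<And>m. sym_coeff F m \<noteq> 0 \<Longrightarrow> mdeg m \<le> d"
    using sym_coeff[of F] by (auto simp: bounded_degree_def)
  have "expo ` {shape m | m. sym_coeff F m \<noteq> 0} \<subseteq>
      {g. \<forall>i. (i \<in> {..d} \<longrightarrow> g i \<in> {..d}) \<and> (i \<notin> {..d} \<longrightarrow> g i = 0)}"
  proof clarify
    fix m i
    assume "sym_coeff F m \<noteq> 0"
    then have m: "mdeg m \<le> d"
      by (rule d)
    have "expo (shape m) i \<le> d"
      using expo_le_mdeg[of "shape m" i] card_keys_le_mdeg[of m] m by (simp add: mdeg_shape)
    moreover have "expo (shape m) i = 0" if "\<not> i \<le> d"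
    proof -
      have "expo m j - 1 \<noteq> i" for j
        using expo_le_mdeg[of m j] m that by linarith
      then show ?thesis
        by (simp add: shape_def lookup_sum lookup_single when_def)
    qed
    ultimately show "(i \<in> {..d} \<longrightarrow> expo (shape m) i \<in> {..d}) \<and> (i \<notin> {..d} \<longrightarrow> expo (shape m) i = 0)"
      by auto
  qed
  moreover have "finite {g. \<forall>i. (i \<in> {..d} \<longrightarrow> g i \<in> {..d}) \<and> (i \<notin> {..d} \<longrightarrow> g i = (0::nat))}"
    by (rule finite_set_of_finite_funs) auto
  ultimately have "finite (expo ` {shape m | m. sym_coeff F m \<noteq> 0})"
    by (rule finite_subset)
  then show ?thesis
    by (rule finite_imageD) (auto intro!: inj_onI poly_mapping_eqI)
qed

text \<open>The part of \<open>F\<close> with the largest number of parts is cancelled by a combination of power sum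
  monomials, which alters besides only terms with fewer parts.\<close>

lemma surj_power_sum_poly: "surj (power_sum_poly :: 'a::field_char_0 ypoly \<Rightarrow> 'a symfun)"
proof -
  interpret crhom "power_sum_poly :: 'a ypoly \<Rightarrow> 'a symfun"
    by (rule crhom_power_sum_poly)
  \<comment> \<open>\<open>L\<close> is a strict bound on the number of parts; for
    \<open>L = 0\<close> no monomial remains and \<open>F\<close> is 0.\<close>
  have range: "F \<in> range power_sum_poly" if "\<forall>m. sym_coeff F m \<noteq> 0 \<longrightarrow> mdeg (shape m) < L"
    for F :: "'a symfun" and L
    using that
  proof (induction L arbitrary: F)
    case 0
    then have "sym_coeff F = sym_coeff 0"
      by (intro ext) (auto simp: zero_symfun.rep_eq)
    then have "F = power_sum_poly 0"
      by (simp only: sym_coeff_inject zero)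
    then show ?case
      by (rule range_eqI)
  next
    case (Suc L)
    define S where "S = {c \<in> {shape m | m. sym_coeff F m \<noteq> 0}. mdeg c = L}"
    have fin: "finite S"
      by (rule finite_subset[OF _ finite_shapes[of F]]) (auto simp only: S_def)
    define u where "u c = (SOME m. shape m = c)" for c
    have u: "shape (u c) = c" for c
      unfolding u_def by (rule someI_ex[OF ex_shape])
    \<comment> \<open>The diagonal denominator is nonzero in characteristic 0. By symmetry, the
      match at the representative \<open>u c\<close> extends to every monomial of shape
      \<open>c\<close>.\<close>
    define a where "a c = sym_coeff F (u c) / sym_coeff (power_sum_monomial c) (u c)" for c
    define P where "P = (\<Sum>c\<in>S. Poly_Mapping.single c (a c))"
    have P: "power_sum_poly P = (\<Sum>c\<in>S. sym_const (a c) * power_sum_monomial c)"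
      unfolding P_def sum power_sum_poly_single ..
    have "mdeg (shape m) < L" if nz: "sym_coeff (F - power_sum_poly P) m \<noteq> 0" for m
    proof (rule ccontr)
      assume not: "\<not> mdeg (shape m) < L"
      have eq: "sym_coeff (F - power_sum_poly P) m =
          sym_coeff F m - (\<Sum>c\<in>S. a c * sym_coeff (power_sum_monomial c) m)"
        by (simp add: P sym_coeff_diff sym_coeff_sum sym_coeff_const_mult)
      \<comment> \<open>All partitions in \<open>S\<close> have \<open>L\<close> parts, and
        \<open>m\<close> has at least \<open>L\<close>, so triangularity permits only the diagonal
        term.\<close>
      have other: "sym_coeff (power_sum_monomial c :: 'a symfun) m = 0" if "c \<in> S" "c \<noteq> shape m" for c
      proof -
        have "mdeg c = L"
          using that(1) by (simp add: S_def)
        then show ?thesis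
          using sym_coeff_power_sum_monomial_nonzero[of c m, where ?'a = 'a] that(2) not by metis
      qed
      show False
      proof (cases "shape m \<in> S")
        case True
        have "(\<Sum>c\<in>S. a c * sym_coeff (power_sum_monomial c) m) =
            (\<Sum>c\<in>{shape m}. a c * sym_coeff (power_sum_monomial c) m)"
          using True other by (intro sum.mono_neutral_right fin) auto
        moreover have "a (shape m) * sym_coeff (power_sum_monomial (shape m)) m = sym_coeff F m"
          using sym_coeff_power_sum_monomial_shape[of m, where ?'a = 'a]
            sym_coeff_eq_if_shape_eq[OF u[of "shape m"], of F]
            sym_coeff_eq_if_shape_eq[OF u[of "shape m"], of "power_sum_monomial (shape m) :: 'a symfun"]
          by (simp add: a_def)
        ultimately show False
          using nz eq by simp
      next
        case False
        have "(\<Sum>c\<in>S. a c * sym_coeff (power_sum_monomial c) m) = 0"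
          using False other by (intro sum.neutral) auto
        then have "sym_coeff F m \<noteq> 0"
          using nz eq by simp
        then have "shape m \<in> S"
          using Suc.prems[rule_format, of m] not unfolding S_def by (intro CollectI conjI exI[of _ m]) auto
        then show False
          using False by simp
      qed
    qed
    then obtain Q where "F - power_sum_poly P = power_sum_poly Q"
      using Suc.IH by blast
    then have "F = power_sum_poly (P + Q)"
      by (simp add: add diff_eq_eq add.commute)
    then show ?case
      by (rule range_eqI)
  qed
  have "F \<in> range power_sum_poly" for F :: "'a symfun"
  proof -
    have "finite (mdeg ` {shape m | m. sym_coeff F m \<noteq> 0})"
      by (rule finite_imageI[OF finite_shapes])
    then obtain L where "\<forall>n\<in>mdeg ` {shape m | m. sym_coeff F m \<noteq> 0}. n < L"
      by (auto simp: finite_nat_set_iff_bounded)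
    then show ?thesis
      by (intro range[of F L]) auto
  qed
  then show ?thesis
    by auto
qed

text \<open>Surjectivity of \<open>power_sum_poly\<close> transfers the induction rule for
  polynomials.\<close>

lemma symfun_induct [case_names const power_sum add mult]:
  fixes F :: "'a::field_char_0 symfun"
  assumes const: "\<And>a. Q (sym_const a)"
    and power_sum: "\<And>n. n \<ge> 1 \<Longrightarrow> Q (sym_p n)"
    and add: "\<And>F G. Q F \<Longrightarrow> Q G \<Longrightarrow> Q (F + G)"
    and mult: "\<And>F G. Q F \<Longrightarrow> Q G \<Longrightarrow> Q (F * G)"
  shows "Q F"
proof -
  interpret crhom "power_sum_poly :: 'a ypoly \<Rightarrow> 'a symfun"
    by (rule crhom_power_sum_poly)
  obtain P where P: "F = power_sum_poly P"
    using surj_power_sum_poly by (metis surjD)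
  have gen: "power_sum_poly (yconst a) = (sym_const a :: 'a symfun)"
    "power_sum_poly (yvar i) = (sym_p (Suc i) :: 'a symfun)" for a i
    by (simp_all add: power_sum_poly_def crhom.ysubst_yconst[OF crhom_sym_const]
        crhom.ysubst_yvar[OF crhom_sym_const])
  have "Q (power_sum_poly P)"
    by (induction P rule: ypoly_induct) (simp_all add: simps gen assms del: One_nat_def)
  then show ?thesis
    by (simp add: P)
qed

section \<open>Plethysm\<close>

lemma crhom_if_is_pleth:
  assumes "crhom \<iota>" "is_pleth \<iota> a \<phi>"
  shows "crhom \<phi>"
proof
  have "\<phi> (sym_const 1) = 1"
    using assms by (simp add: is_pleth_def crhom.one)
  then show "\<phi> 1 = 1"
    by (simp add: crhom.one[OF crhom_sym_const])
qed (use assms in \<open>simp_all add: is_pleth_def\<close>)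

lemma is_pleth_unique:
  fixes F :: "'a::field_char_0 symfun"
  assumes "is_pleth \<iota> a \<phi>" "is_pleth \<iota> a \<psi>"
  shows "\<phi> F = \<psi> F"
  using assms by (induction F rule: symfun_induct) (auto simp: is_pleth_def)

text \<open>Existence: write \<open>F\<close> as a polynomial in the power sums, uniquely by
  injectivity, and substitute. The shift in \<open>a (Suc i)\<close> matches variable
  \<open>i\<close> with the power sum of degree \<open>i + 1\<close>.\<close>

lemma is_pleth_pleth:
  fixes \<iota> :: "'a::field_char_0 \<Rightarrow> 'b::comm_ring_1"
  assumes "crhom \<iota>"
  shows "is_pleth \<iota> a (pleth \<iota> a)"
proof -
  interpret crhom \<iota>
    by fact
  interpret E: crhom "ysubst \<iota> (\<lambda>i. a (Suc i))"
    by (rule crhom_ysubst)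
  interpret P: crhom "power_sum_poly :: 'a ypoly \<Rightarrow> 'a symfun"
    by (rule crhom_power_sum_poly)
  let ?inv = "inv (power_sum_poly :: 'a ypoly \<Rightarrow> 'a symfun)"
  have inv: "?inv F = P" if "power_sum_poly P = F" for F P
    using that inj_power_sum_poly by (metis inv_f_f)
  have surj: "power_sum_poly (?inv F) = F" for F
    by (rule surj_f_inv_f[OF surj_power_sum_poly])
  have ex: "is_pleth \<iota> a (\<lambda>F. ysubst \<iota> (\<lambda>i. a (Suc i)) (?inv F))"
    unfolding is_pleth_def
  proof (intro conjI allI impI)
    fix F G :: "'a symfun"
    show "ysubst \<iota> (\<lambda>i. a (Suc i)) (?inv (F + G)) =
        ysubst \<iota> (\<lambda>i. a (Suc i)) (?inv F) + ysubst \<iota> (\<lambda>i. a (Suc i)) (?inv G)"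
      by (subst inv[of "?inv F + ?inv G"]) (simp_all add: P.add surj E.add)
    show "ysubst \<iota> (\<lambda>i. a (Suc i)) (?inv (F * G)) =
        ysubst \<iota> (\<lambda>i. a (Suc i)) (?inv F) * ysubst \<iota> (\<lambda>i. a (Suc i)) (?inv G)"
      by (subst inv[of "?inv F * ?inv G"]) (simp_all add: P.mult surj E.mult)
  next
    fix c
    show "ysubst \<iota> (\<lambda>i. a (Suc i)) (?inv (sym_const c)) = \<iota> c"
      by (subst inv[of "yconst c"])
        (simp_all add: power_sum_poly_def crhom.ysubst_yconst[OF crhom_sym_const] ysubst_yconst)
  next
    fix n :: nat
    assume "1 \<le> n"
    then show "ysubst \<iota> (\<lambda>i. a (Suc i)) (?inv (sym_p n)) = a n"
      by (subst inv[of "yvar (n - 1)"])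
        (simp_all add: power_sum_poly_def crhom.ysubst_yvar[OF crhom_sym_const] ysubst_yvar)
  qed
  show ?thesis
    unfolding pleth_def
    by (rule theI[of "is_pleth \<iota> a", OF ex]) (rule ext, erule is_pleth_unique, rule ex)
qed

lemma pleth_eqI:
  fixes \<iota> :: "'a::field_char_0 \<Rightarrow> 'b::comm_ring_1"
  assumes "crhom \<iota>" "is_pleth \<iota> a \<phi>"
  shows "pleth \<iota> a = \<phi>"
  using is_pleth_unique[OF is_pleth_pleth[OF assms(1)] assms(2)] by blast

lemma crhom_pleth:
  fixes \<iota> :: "'a::field_char_0 \<Rightarrow> 'b::comm_ring_1"
  assumes "crhom \<iota>"
  shows "crhom (pleth \<iota> a)"
  by (rule crhom_if_is_pleth[OF assms is_pleth_pleth[OF assms]])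

lemma pleth_sym_const:
  fixes \<iota> :: "'a::field_char_0 \<Rightarrow> 'b::comm_ring_1"
  shows "crhom \<iota> \<Longrightarrow> pleth \<iota> a (sym_const c) = \<iota> c"
  using is_pleth_pleth[of \<iota> a] by (simp add: is_pleth_def)

lemma pleth_sym_p:
  fixes \<iota> :: "'a::field_char_0 \<Rightarrow> 'b::comm_ring_1"
  shows "crhom \<iota> \<Longrightarrow> n \<ge> 1 \<Longrightarrow> pleth \<iota> a (sym_p n) = a n"
  using is_pleth_pleth[of \<iota> a] by (simp add: is_pleth_def)

lemma is_plethI:
  assumes "crhom \<phi>" "\<And>c. \<phi> (sym_const c) = \<iota> c" "\<And>n. n \<ge> 1 \<Longrightarrow> \<phi> (sym_p n) = a n"
  shows "is_pleth \<iota> a \<phi>"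
  using assms by (simp add: is_pleth_def crhom_def)

text \<open>Serves to compare an evaluation after a plethystic shift with another evaluation, on
  scalars, power sums and variables only.\<close>

lemma crhom_symfun_ypoly_eqI:
  fixes f g :: "'a::field_char_0 symfun ypoly \<Rightarrow> 'b::comm_ring_1"
  assumes f: "crhom f" and g: "crhom g"
    and const: "\<And>c. f (yconst (sym_const c)) = g (yconst (sym_const c))"
    and p: "\<And>n. n \<ge> 1 \<Longrightarrow> f (yconst (sym_p n)) = g (yconst (sym_p n))"
    and var: "\<And>i. f (yvar i) = g (yvar i)"
  shows "f P = g P"
proof (rule crhom_ypoly_eqI[OF f g _ var])
  fix F :: "'a symfun"
  interpret f: crhom f by fact
  interpret g: crhom g by fact
  interpret y: crhom "yconst :: 'a symfun \<Rightarrow> _"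
    by (rule crhom_yconst)
  show "f (yconst F) = g (yconst F)"
    by (induction F rule: symfun_induct)
      (simp_all add: const p f.add g.add y.add f.mult g.mult y.mult del: One_nat_def)
qed

section \<open>Homogeneous components and the plethystic exponential\<close>

lift_definition sym_hom :: "nat \<Rightarrow> 'a::comm_ring_1 symfun \<Rightarrow> 'a symfun"
  is "\<lambda>d f m. if mdeg m = d then f m else 0"
  by (auto simp: bounded_degree_def permutation_invariant_def mdeg_map_key)

lemma sym_hom_add: "sym_hom d (F + G) = sym_hom d F + sym_hom d G"
  by (rule symfun_eqI) (simp add: sym_hom.rep_eq sym_coeff_add)

text \<open>Degrees add under multiplication, so for each splitting of a monomial only
  \<open>i = mdeg a\<close> can contribute.\<close>

lemma sym_hom_mult: "sym_hom d (F * G) = (\<Sum>i\<le>d. sym_hom i F * sym_hom (d - i) G)"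
proof (rule symfun_eqI)
  fix m
  let ?c = "sym_coeff"
  have inner: "(\<Sum>i\<le>d. ?c (sym_hom i F) a * ?c (sym_hom (d - i) G) b) =
      (if mdeg m = d then ?c F a * ?c G b else 0)" if "a + b = m" for a b
  proof -
    have "(\<Sum>i\<le>d. ?c (sym_hom i F) a * ?c (sym_hom (d - i) G) b) =
        (\<Sum>i\<le>d. if i = mdeg a then (if mdeg b = d - mdeg a then ?c F a * ?c G b else 0) else 0)"
      by (rule sum.cong) (auto simp: sym_hom.rep_eq)
    also have "\<dots> = (if mdeg m = d then ?c F a * ?c G b else 0)"
      using that by (auto simp: mdeg_add)
    finally show ?thesis .
  qed
  have "?c (\<Sum>i\<le>d. sym_hom i F * sym_hom (d - i) G) m =
      (\<Sum>i\<le>d. \<Sum>(a, b) | a + b = m. ?c (sym_hom i F) a * ?c (sym_hom (d - i) G) b)"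
    by (simp add: sym_coeff_sum times_symfun.rep_eq conv_def)
  also have "\<dots> = (\<Sum>p | fst p + snd p = m.
      \<Sum>i\<le>d. ?c (sym_hom i F) (fst p) * ?c (sym_hom (d - i) G) (snd p))"
    unfolding case_prod_unfold by (rule sum.swap)
  also have "\<dots> = (\<Sum>p | fst p + snd p = m. if mdeg m = d then ?c F (fst p) * ?c G (snd p) else 0)"
    by (rule sum.cong[OF refl], rule inner) simp
  also have "\<dots> = ?c (sym_hom d (F * G)) m"
    by (simp add: sym_hom.rep_eq times_symfun.rep_eq conv_def case_prod_unfold)
  finally show "?c (sym_hom d (F * G)) m = ?c (\<Sum>i\<le>d. sym_hom i F * sym_hom (d - i) G) m"
    by (rule sym)
qed

lemma sym_hom_const: "sym_hom d (sym_const c) = (if d = 0 then sym_const c else 0)"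
  by (rule symfun_eqI) (auto simp: sym_hom.rep_eq sym_const.rep_eq)

lemma sym_hom_1: "sym_hom d 1 = (if d = 0 then 1 else 0)"
  by (rule symfun_eqI) (auto simp: sym_hom.rep_eq one_symfun.rep_eq)

lemma sym_hom_p: "sym_hom d (sym_p n) = (if d = n then sym_p n else 0)"
  by (rule symfun_eqI) (auto simp: sym_hom.rep_eq sym_p.rep_eq)

lemma sym_hom_h: "sym_hom d (sym_h n) = (if d = n then sym_h n else 0)"
  by (rule symfun_eqI) (auto simp: sym_hom.rep_eq sym_h.rep_eq)

text \<open>The power of \<open>fps_X\<close> attached to each power sum records its degree. The
  right-hand side is a homomorphism with the same values on generators.\<close>

lemma pleth_graded:
  fixes \<iota> :: "'a::field_char_0 \<Rightarrow> 'b::comm_ring_1"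
  assumes "crhom \<iota>"
  shows "pleth (fps_const \<circ> \<iota>) (\<lambda>n. fps_X ^ n * fps_const (b n)) F =
    Abs_fps (\<lambda>n. pleth \<iota> b (sym_hom n F))"
proof -
  interpret crhom "pleth \<iota> b"
    by (rule crhom_pleth[OF assms])
  interpret \<iota>: crhom \<iota> by fact
  have ex: "is_pleth (fps_const \<circ> \<iota>) (\<lambda>n. fps_X ^ n * fps_const (b n))
      (\<lambda>F. Abs_fps (\<lambda>n. pleth \<iota> b (sym_hom n F)))"
  proof (rule is_plethI)
    show "crhom (\<lambda>F. Abs_fps (\<lambda>n. pleth \<iota> b (sym_hom n F)))"
      by unfold_locales
        (simp_all add: fps_eq_iff sym_hom_add add sym_hom_mult sum mult fps_mult_nth
          atMost_atLeast0 sym_hom_1 one zero)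
  qed (auto simp: fps_eq_iff sym_hom_const sym_hom_p zero pleth_sym_const[OF assms]
      pleth_sym_p[OF assms] fps_X_power_nth)
  have "crhom (fps_const \<circ> \<iota>)"
    by unfold_locales (simp_all add: \<iota>.simps)
  from pleth_eqI[OF this ex] show ?thesis
    by simp
qed

text \<open>Since \<open>sym_h n\<close> is homogeneous, the summand of index \<open>n\<close> is a
  single term of degree \<open>n\<close>, and the infinite sum merely collects coefficients.\<close>

lemma pleth_Exp_graded:
  fixes \<iota> :: "'a::field_char_0 \<Rightarrow> 'b::comm_ring_1"
  assumes "crhom \<iota>"
  shows "pleth_Exp (fps_const \<circ> \<iota>) (\<lambda>n. fps_X ^ n * fps_const (b n)) =
    Abs_fps (\<lambda>n. pleth \<iota> b (sym_h n))"
proof -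
  let ?e = "Abs_fps (\<lambda>n. pleth \<iota> b (sym_h n))"
  have "pleth (fps_const \<circ> \<iota>) (\<lambda>n. fps_X ^ n * fps_const (b n)) (sym_h n) =
      fps_const (fps_nth ?e n) * fps_X ^ n" for n
    unfolding pleth_graded[OF assms]
    by (auto simp: fps_eq_iff sym_hom_h crhom.zero[OF crhom_pleth[OF assms]] fps_X_power_nth)
  moreover have "(\<lambda>n. fps_const (fps_nth ?e n) * fps_X ^ n) sums ?e"
    unfolding sums_def_le atMost_atLeast0 by (rule fps_notation)
  ultimately show ?thesis
    unfolding pleth_Exp_def by (simp add: sums_unique[symmetric])
qed

section \<open>Specialization to one variable\<close>

lemma single_eq_0_iff: "Poly_Mapping.single i n = (0 :: nat \<Rightarrow>\<^sub>0 nat) \<longleftrightarrow> n = 0"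
proof
  assume "Poly_Mapping.single i n = (0 :: nat \<Rightarrow>\<^sub>0 nat)"
  then have "mdeg (Poly_Mapping.single i n) = mdeg 0"
    by (rule arg_cong)
  then show "n = 0"
    by simp
qed simp

text \<open>All variables except the one of index 0 are set to zero. Bounded degree ensures that the
  result is a polynomial.\<close>

definition one_variable :: "'a::comm_ring_1 symfun \<Rightarrow> 'a poly"
  where "one_variable F = Abs_poly (\<lambda>j. sym_coeff F (Poly_Mapping.single 0 j))"

lemma coeff_one_variable: "coeff (one_variable F) j = sym_coeff F (Poly_Mapping.single 0 j)"
proof -
  obtain d where d: "\<And>m. sym_coeff F m \<noteq> 0 \<Longrightarrow> mdeg m \<le> d"
    using sym_coeff[of F] by (auto simp: bounded_degree_def)
  show ?thesis
    unfolding one_variable_def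
  proof (subst coeff_Abs_poly[of d])
    fix i :: nat
    assume "i > d"
    then show "sym_coeff F (Poly_Mapping.single 0 i) = 0"
      using d[of "Poly_Mapping.single 0 i"] by auto
  qed simp
qed

lemma crhom_one_variable: "crhom one_variable"
proof
  fix F G :: "'a symfun"
  show "one_variable (F + G) = one_variable F + one_variable G"
    by (rule poly_eqI) (simp add: coeff_one_variable sym_coeff_add)
  show "one_variable 1 = (1 :: 'a poly)"
    by (rule poly_eqI) (simp add: coeff_one_variable one_symfun.rep_eq single_eq_0_iff)
  \<comment> \<open>A power of the variable of index 0 splits only into powers of that variable, so
    convolution becomes the Cauchy product.\<close>
  have eq: "(\<lambda>i. (Poly_Mapping.single 0 i, Poly_Mapping.single 0 (n - i))) ` {..n} =
      {(a, b). a + b = Poly_Mapping.single (0 :: nat) n}" for n :: nat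
  proof (intro equalityI subsetI)
    fix p
    assume "p \<in> {(a, b). a + b = Poly_Mapping.single (0 :: nat) n}"
    then obtain a b where p: "p = (a, b)" "a + b = Poly_Mapping.single 0 n"
      by auto
    have sum: "expo a i + expo b i = expo (Poly_Mapping.single 0 n) i" for i
      by (simp add: p(2)[symmetric] lookup_add)
    have "expo a i = 0 \<and> expo b i = 0" if "i \<noteq> 0" for i
      using sum[of i] that by (simp add: lookup_single)
    moreover have "expo a 0 + expo b 0 = n"
      using sum[of 0] by simp
    ultimately have "a = Poly_Mapping.single 0 (expo a 0)" "b = Poly_Mapping.single 0 (n - expo a 0)"
      "expo a 0 \<le> n"
      by (auto intro!: poly_mapping_eqI simp: lookup_single when_def)
    then show "p \<in> (\<lambda>i. (Poly_Mapping.single 0 i, Poly_Mapping.single 0 (n - i))) ` {..n}"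
      unfolding p(1) by (intro image_eqI[of _ _ "expo a 0"]) auto
  qed (auto simp: single_add[symmetric])
  have inj: "inj_on (\<lambda>i. (Poly_Mapping.single (0 :: nat) i, Poly_Mapping.single (0 :: nat) (n - i))) {..n}"
    for n :: nat
    by (rule inj_onI) (auto dest: arg_cong[of _ _ mdeg])
  show "one_variable (F * G) = one_variable F * one_variable G"
    by (rule poly_eqI)
      (simp add: coeff_one_variable times_symfun.rep_eq conv_def coeff_mult eq[symmetric] sum.reindex[OF inj])
qed

text \<open>In one variable both the power sum and the complete homogeneous function of degree n
  become x^n, and this specialization realizes the plethysm.\<close>

lemma pleth_power_sym_h: "pleth id (\<lambda>n. x ^ n) (sym_h n) = (x :: 'a::field_char_0) ^ n"
proof -
  interpret crhom "one_variable :: 'a symfun \<Rightarrow> 'a poly"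
    by (rule crhom_one_variable)
  have p: "one_variable (sym_p n) = monom (1 :: 'a) n" if "n \<ge> 1" for n
    using that by (intro poly_eqI)
      (auto simp: coeff_one_variable sym_p.rep_eq dest: arg_cong[of _ _ mdeg])
  have h: "one_variable (sym_h n) = monom (1 :: 'a) n"
    by (rule poly_eqI) (simp add: coeff_one_variable sym_h.rep_eq)
  have const: "one_variable (sym_const c) = [:c:]" for c :: 'a
  proof (rule poly_eqI)
    fix j
    show "coeff (one_variable (sym_const c)) j = coeff [:c:] j"
      by (simp add: coeff_one_variable sym_const.rep_eq single_eq_0_iff coeff_pCons split: nat.split)
  qed
  have "is_pleth id (\<lambda>n. x ^ n) (\<lambda>F. poly (one_variable F) x)"
    by (rule is_plethI) (unfold_locales, simp_all add: simps p const poly_monom)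
  then have "pleth id (\<lambda>n. x ^ n) = (\<lambda>F. poly (one_variable F) x)"
    by (rule pleth_eqI[OF crhom_id])
  then show ?thesis
    by (simp add: h poly_monom)
qed

section \<open>The ground field\<close>

text \<open>Provides characteristic 0 for \<open>qtfield\<close>, as the existence of plethysm
  demands.\<close>

instance fract :: ("{idom, ring_char_0}") field_char_0
proof
  show "inj (of_nat :: nat \<Rightarrow> 'a fract)"
    by (rule injI) (simp add: of_nat_fract eq_fract)
qed

lemma qvar_neq_0: "qvar \<noteq> 0" and qvar_neq_1: "qvar \<noteq> 1"
  by (simp_all add: qvar_def Zero_fract_def One_fract_def eq_fract one_pCons)

section \<open>Closure properties of \<open>V\<^sub>k\<close>\<close>

lemma Vspace_yconst: "yconst F \<in> Vspace k"
  by (auto simp: Vspace_def yconst_def)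

lemma Vspace_yvar: "i \<in> {1..k} \<Longrightarrow> yvar i \<in> Vspace k"
  by (auto simp: Vspace_def yvar_def)

lemma Vspace_add: "F \<in> Vspace k \<Longrightarrow> G \<in> Vspace k \<Longrightarrow> F + G \<in> Vspace k"
  using Poly_Mapping.keys_add[of F G] by (auto simp: Vspace_def)

lemma Vspace_mult: "F \<in> Vspace k \<Longrightarrow> G \<in> Vspace k \<Longrightarrow> F * G \<in> Vspace k"
  using keys_mult[of F G] by (fastforce simp: Vspace_def keys_add_nat)

lemma Vspace_Vconst: "Vconst c \<in> Vspace k"
  unfolding Vconst_def by (rule Vspace_yconst)

lemma Vspace_1: "1 \<in> Vspace k"
  using Vspace_yconst[of 1 k] by (simp add: crhom.one[OF crhom_yconst])

lemma Vspace_0: "0 \<in> Vspace k"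
  using Vspace_yconst[of 0 k] by (simp add: crhom.zero[OF crhom_yconst])

lemma Vspace_uminus: "F \<in> Vspace k \<Longrightarrow> - F \<in> Vspace k"
  by (simp add: Vspace_def)

lemma Vspace_diff: "F \<in> Vspace k \<Longrightarrow> G \<in> Vspace k \<Longrightarrow> F - G \<in> Vspace k"
  using Vspace_add[OF _ Vspace_uminus, of F k G] by simp

lemma Vspace_power: "F \<in> Vspace k \<Longrightarrow> F ^ n \<in> Vspace k"
  by (induction n) (simp_all add: Vspace_1 Vspace_mult)

lemmas Vspace_closed = Vspace_yconst Vspace_Vconst Vspace_1 Vspace_0 Vspace_add Vspace_mult
  Vspace_uminus Vspace_diff Vspace_power

lemma Vspace_induct [consumes 1, case_names const var add mult]:
  assumes "F \<in> Vspace k"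
    and "\<And>a. Q (yconst a)" "\<And>i. i \<in> {1..k} \<Longrightarrow> Q (yvar i)"
    and "\<And>F G. Q F \<Longrightarrow> Q G \<Longrightarrow> Q (F + G)" "\<And>F G. Q F \<Longrightarrow> Q G \<Longrightarrow> Q (F * G)"
  shows "Q F"
  by (rule ypoly_induct_on[where A = "{1..k}"]) (use assms in \<open>auto simp: Vspace_def\<close>)

text \<open>Multiplies by one generator at a time; suited to properties that are linear but not
  multiplicative, such as those of Laurent coefficients.\<close>

lemma Vspace_module_induct [consumes 1, case_names one const var add]:
  assumes F: "F \<in> Vspace k"
    and one: "Q 1"
    and const: "\<And>a F. Q F \<Longrightarrow> Q (yconst a * F)"
    and var: "\<And>i F. i \<in> {1..k} \<Longrightarrow> Q F \<Longrightarrow> Q (yvar i * F)"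
    and add: "\<And>F G. Q F \<Longrightarrow> Q G \<Longrightarrow> Q (F + G)"
  shows "Q F"
proof -
  have "Q (F * G)" if "Q G" for G
    using F that
  proof (induction F arbitrary: G rule: Vspace_induct)
    case (add F G H)
    then show ?case
      by (simp add: distrib_right assms(5))
  next
    case (mult F G H)
    then show ?case
      by (simp add: mult.assoc)
  qed (simp_all add: const var)
  from this[OF one] show ?thesis
    by simp
qed

lemma ysubst_Vspace:
  assumes c: "crhom c" "\<And>F. c F \<in> Vspace l" and v: "\<And>i. i \<in> {1..k} \<Longrightarrow> v i \<in> Vspace l"
    and F: "F \<in> Vspace k"
  shows "ysubst c v F \<in> Vspace l"
proof -
  interpret c: crhom c by fact
  interpret crhom "ysubst c v"
    by (rule c.crhom_ysubst)
  show ?thesis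
    using F by (induction F rule: Vspace_induct)
      (simp_all add: c.ysubst_yconst c.ysubst_yvar c v add mult Vspace_closed)
qed

lemma crhom_Vconst: "crhom Vconst"
proof -
  interpret y: crhom "yconst :: qtfield symfun \<Rightarrow> V"
    by (rule crhom_yconst)
  interpret c: crhom "sym_const :: qtfield \<Rightarrow> qtfield symfun"
    by (rule crhom_sym_const)
  show ?thesis
    by unfold_locales (simp_all add: Vconst_def y.simps c.simps)
qed

lemma pleth_Vspace:
  assumes "\<And>n. a n \<in> Vspace l"
  shows "pleth Vconst a F \<in> Vspace l"
proof -
  interpret crhom "pleth Vconst a"
    by (rule crhom_pleth[OF crhom_Vconst])
  show ?thesis
    by (induction F rule: symfun_induct)
      (simp_all add: pleth_sym_const[OF crhom_Vconst] pleth_sym_p[OF crhom_Vconst]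
        add mult Vspace_closed assms del: One_nat_def)
qed

lemma crhom_Vpleth: "crhom (Vpleth a)"
  unfolding Vpleth_def by (rule crhom.crhom_ysubst[OF crhom_pleth[OF crhom_Vconst]])

lemma Vpleth_gens:
  shows "Vpleth a (yconst (sym_const c)) = Vconst c"
    and "n \<ge> 1 \<Longrightarrow> Vpleth a (yconst (sym_p n)) = a n"
    and "Vpleth a (yvar i) = yvar i"
  by (simp_all add: Vpleth_def crhom.ysubst_yconst[OF crhom_pleth[OF crhom_Vconst]]
      crhom.ysubst_yvar[OF crhom_pleth[OF crhom_Vconst]] pleth_sym_const[OF crhom_Vconst]
      pleth_sym_p[OF crhom_Vconst])

lemma Vpleth_Vspace:
  assumes "\<And>n. a n \<in> Vspace l" "k \<le> l" "F \<in> Vspace k"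
  shows "Vpleth a F \<in> Vspace l"
  unfolding Vpleth_def
  by (rule ysubst_Vspace[OF crhom_pleth[OF crhom_Vconst] pleth_Vspace _ assms(3)])
    (use assms in \<open>auto intro: Vspace_yvar\<close>)

section \<open>The evaluation of \<open>V\<^sub>k\<close> and the operators\<close>

text \<open>The \<open>k\<close> enters only through F[-q^k]; the values of the variables do not
  depend on it. Hence \<open>eval_V l\<close> also makes sense on \<open>Vspace (Suc l)\<close>,
  with q^l for the last variable.\<close>

definition eval_V :: "nat \<Rightarrow> V \<Rightarrow> qtfield"
  where "eval_V k = ysubst (pleth id (\<lambda>n. - (qvar ^ (n * k)))) (\<lambda>i. qvar ^ (i - 1))"

lemma crhom_eval_V: "crhom (eval_V k)"
  unfolding eval_V_def by (rule crhom.crhom_ysubst[OF crhom_pleth[OF crhom_id]])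

lemma eval_V_gens:
  shows "eval_V k (yconst (sym_const c)) = c"
    and "eval_V k (Vconst c) = c"
    and "n \<ge> 1 \<Longrightarrow> eval_V k (yconst (sym_p n)) = - (qvar ^ (n * k))"
    and "eval_V k (yvar i) = qvar ^ (i - 1)"
  by (simp_all add: Vconst_def eval_V_def crhom.ysubst_yconst[OF crhom_pleth[OF crhom_id]]
      crhom.ysubst_yvar[OF crhom_pleth[OF crhom_id]] pleth_sym_const[OF crhom_id]
      pleth_sym_p[OF crhom_id])

section \<open>Divided differences and the operators T_i\<close>

lemma lookup_yvar_mult_neq_0:
  fixes R :: "'a::comm_ring_1 ypoly"
  assumes "Poly_Mapping.lookup (yvar i * R) u \<noteq> 0"
  obtains m where "m \<in> Poly_Mapping.keys R" "u = Poly_Mapping.single i 1 + m"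
proof -
  have "u \<in> Poly_Mapping.keys (yvar i * R)"
    using assms by (simp add: in_keys_iff)
  then show ?thesis
    using keys_mult[of "yvar i" R] that by (auto simp: yvar_def)
qed

lemma lookup_yvar_mult:
  fixes R :: "'a::comm_ring_1 ypoly"
  shows "Poly_Mapping.lookup (yvar i * R) (Poly_Mapping.single i 1 + m) = Poly_Mapping.lookup R m"
proof -
  have "yvar i * R = (\<Sum>u\<in>Poly_Mapping.keys R.
      Poly_Mapping.single (Poly_Mapping.single i 1 + u) (Poly_Mapping.lookup R u))"
    by (subst ypoly_sum_single[of R]) (simp add: yvar_def sum_distrib_left mult_single)
  then show ?thesis
    by (simp add: lookup_sum lookup_single when_def in_keys_iff)
qed

text \<open>Look at a monomial of \<open>R\<close> of largest degree in \<open>y\<^sub>j\<close>.\<close>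

lemma yvar_diff_mult_eq_0:
  fixes R :: "'a::comm_ring_1 ypoly"
  assumes "i \<noteq> j" and eq: "(yvar j - yvar i) * R = 0"
  shows "R = 0"
proof (rule ccontr)
  assume "R \<noteq> 0"
  let ?M = "(\<lambda>m. expo m j) ` Poly_Mapping.keys R"
  have "Max ?M \<in> ?M"
    using \<open>R \<noteq> 0\<close> by (intro Max_in) auto
  then obtain m where m: "m \<in> Poly_Mapping.keys R" and "expo m j = Max ?M"
    by auto
  then have max: "expo u j \<le> expo m j" if "u \<in> Poly_Mapping.keys R" for u
    using that by simp
  have "yvar j * R = yvar i * R"
    using eq by (simp add: left_diff_distrib)
  then have "Poly_Mapping.lookup (yvar i * R) (Poly_Mapping.single j 1 + m) \<noteq> 0"
    using lookup_yvar_mult[of j R m] m by (simp add: in_keys_iff)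
  then obtain u where u: "u \<in> Poly_Mapping.keys R"
    and "Poly_Mapping.single j 1 + m = Poly_Mapping.single i 1 + u"
    by (rule lookup_yvar_mult_neq_0)
  then have "expo (Poly_Mapping.single j 1 + m) j = expo (Poly_Mapping.single i 1 + u) j"
    by simp
  then have "Suc (expo m j) = expo u j"
    using assms(1) by (simp add: lookup_add lookup_single)
  then show False
    using max[OF u] by simp
qed

lemma crhom_swap_y: "crhom (swap_y i)"
  unfolding swap_y_def by (rule crhom.crhom_ysubst[OF crhom_yconst])

lemma swap_y_gens:
  shows "swap_y i (yconst a) = yconst a"
    and "swap_y i (yvar j) = yvar ((id(i := Suc i, Suc i := i)) j)"
  by (simp_all add: swap_y_def crhom.ysubst_yconst[OF crhom_yconst] crhom.ysubst_yvar[OF crhom_yconst])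

lemma swap_y_Vspace:
  assumes "1 \<le> i" "Suc i \<le> k" "P \<in> Vspace k"
  shows "swap_y i P \<in> Vspace k"
  unfolding swap_y_def
  by (rule ysubst_Vspace[OF crhom_yconst Vspace_yconst _ assms(3)])
    (use assms in \<open>auto intro!: Vspace_yvar\<close>)

text \<open>The divided difference exists on generators by inspection and on products by a Leibniz
  rule.\<close>

lemma diff_swap_y_dvd:
  assumes i: "1 \<le> i" "Suc i \<le> k" and P: "P \<in> Vspace k"
  shows "\<exists>D\<in>Vspace k. P - swap_y i P = (yvar (Suc i) - yvar i) * D"
proof -
  interpret S: crhom "swap_y i"
    by (rule crhom_swap_y)
  \<comment> \<open>Membership of \<open>P\<close> is carried along because the product case
    multiplies quotients by \<open>F\<close> and \<open>swap_y i G\<close>.\<close>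
  have "P \<in> Vspace k \<and> (\<exists>D\<in>Vspace k. P - swap_y i P = (yvar (Suc i) - yvar i) * D)"
    using P
  proof (induction P rule: Vspace_induct)
    case (const a)
    then show ?case
      by (auto simp: swap_y_gens Vspace_closed intro!: bexI[of _ 0])
  next
    case (var j)
    then have yj: "yvar j \<in> Vspace k"
      by (rule Vspace_yvar)
    consider "j = i" | "j = Suc i" | "j \<noteq> i" "j \<noteq> Suc i"
      by blast
    then show ?case
    proof cases
      case 1
      then show ?thesis
        using yj by (auto simp: swap_y_gens Vspace_closed intro!: bexI[of _ "- 1"])
    next
      case 2
      then show ?thesis
        using yj by (auto simp: swap_y_gens Vspace_closed intro!: bexI[of _ 1])
    next
      case 3
      then show ?thesis
        using yj by (auto simp: swap_y_gens Vspace_closed intro!: bexI[of _ 0])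
    qed
  next
    case (add F G)
    then obtain D E where "D \<in> Vspace k" "E \<in> Vspace k"
      and D: "F - swap_y i F = (yvar (Suc i) - yvar i) * D"
      and E: "G - swap_y i G = (yvar (Suc i) - yvar i) * E"
      by blast
    have "F + G - swap_y i (F + G) = (F - swap_y i F) + (G - swap_y i G)"
      by (simp add: S.add)
    also have "\<dots> = (yvar (Suc i) - yvar i) * (D + E)"
      by (simp only: D E distrib_left)
    finally show ?case
      using add \<open>D \<in> _\<close> \<open>E \<in> _\<close> by (blast intro: Vspace_add)
  next
    case (mult F G)
    then obtain D E where "D \<in> Vspace k" "E \<in> Vspace k"
      and D: "F - swap_y i F = (yvar (Suc i) - yvar i) * D"
      and E: "G - swap_y i G = (yvar (Suc i) - yvar i) * E"
      by blast
    \<comment> \<open>The twisted Leibniz rule: the swap acts on the second factor of one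
      term.\<close>
    have "F * G - swap_y i (F * G) = F * (G - swap_y i G) + (F - swap_y i F) * swap_y i G"
      by (simp add: S.mult algebra_simps)
    also have "\<dots> = (yvar (Suc i) - yvar i) * (F * E + D * swap_y i G)"
      by (simp only: D E distrib_left mult_ac)
    finally have "F * G - swap_y i (F * G) = (yvar (Suc i) - yvar i) * (F * E + D * swap_y i G)" .
    moreover have "F * E + D * swap_y i G \<in> Vspace k"
      using mult \<open>D \<in> _\<close> \<open>E \<in> _\<close> swap_y_Vspace[OF i] by (blast intro: Vspace_add Vspace_mult)
    ultimately show ?case
      using mult by (blast intro: Vspace_mult)
  qed
  then show ?thesis
    by blast
qed

text \<open>The numerator equals (y_{i+1} - y_i) s_i P + (q - 1) y_i (P - s_i P), so the division is
  exact. The quotient is unique because y_{i+1} - y_i is not a zero divisor, which justifies the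
  \<open>THE\<close> in \<open>T_op\<close>.\<close>

lemma T_op_props:
  assumes i: "1 \<le> i" "Suc i \<le> k" and P: "P \<in> Vspace k"
  shows "T_op i P \<in> Vspace k"
    and "(yvar (Suc i) - yvar i) * T_op i P =
      (Vconst qvar - 1) * yvar i * P + (yvar (Suc i) - Vconst qvar * yvar i) * swap_y i P"
proof -
  let ?rhs = "(Vconst qvar - 1) * yvar i * P + (yvar (Suc i) - Vconst qvar * yvar i) * swap_y i P"
  obtain D where D: "D \<in> Vspace k" "P - swap_y i P = (yvar (Suc i) - yvar i) * D"
    using diff_swap_y_dvd[OF assms] by blast
  define R where "R = swap_y i P + (Vconst qvar - 1) * yvar i * D"
  have "?rhs = (yvar (Suc i) - yvar i) * swap_y i P + (Vconst qvar - 1) * yvar i * (P - swap_y i P)"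
    by (simp add: algebra_simps)
  also have "\<dots> = (yvar (Suc i) - yvar i) * R"
    by (simp add: D(2) R_def distrib_left mult_ac)
  finally have R: "(yvar (Suc i) - yvar i) * R = ?rhs" ..
  have "T_op i P = R"
    unfolding T_op_def
  proof (rule the_equality)
    show "(yvar (Suc i) - yvar i) * R = ?rhs"
      by (rule R)
  next
    fix S
    assume "(yvar (Suc i) - yvar i) * S = ?rhs"
    with R have "(yvar (Suc i) - yvar i) * (S - R) = 0"
      by (simp add: right_diff_distrib)
    then have "S - R = 0"
      by (rule yvar_diff_mult_eq_0[rotated]) simp
    then show "S = R"
      by simp
  qed
  moreover have "R \<in> Vspace k"
    unfolding R_def using i D(1) P
    by (intro Vspace_add Vspace_mult Vspace_diff Vspace_Vconst Vspace_1 Vspace_yvar swap_y_Vspace) auto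
  ultimately show "T_op i P \<in> Vspace k" "(yvar (Suc i) - yvar i) * T_op i P = ?rhs"
    using R by simp_all
qed

text \<open>At \<open>y\<^sub>i\<^sub>+\<^sub>1 = q y\<^sub>i\<close> the term of \<open>T\<^sub>i P\<close> that involves \<open>s\<^sub>i P\<close> vanishes and the other one becomes \<open>P\<close>.\<close>

lemma eval_V_T_op:
  assumes i: "1 \<le> i" "Suc i \<le> k" and P: "P \<in> Vspace k"
  shows "eval_V l (T_op i P) = eval_V l P"
proof -
  interpret crhom "eval_V l"
    by (rule crhom_eval_V)
  have q: "qvar ^ i = qvar * qvar ^ (i - 1)"
    using i by (cases i) auto
  have "eval_V l ((yvar (Suc i) - yvar i) * T_op i P) =
      eval_V l ((Vconst qvar - 1) * yvar i * P + (yvar (Suc i) - Vconst qvar * yvar i) * swap_y i P)"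
    using T_op_props(2)[OF assms] by simp
  then have "(qvar - 1) * qvar ^ (i - 1) * eval_V l (T_op i P) = (qvar - 1) * qvar ^ (i - 1) * eval_V l P"
    by (simp add: simps eval_V_gens q left_diff_distrib)
  \<comment> \<open>The common factor (q - 1) q^(i-1) cancels, q being neither 0 nor 1.\<close>
  then show ?thesis
    using qvar_neq_0 qvar_neq_1 by simp
qed

lemma T_op_foldr:
  assumes "set is \<subseteq> {1..<k}" and P: "P \<in> Vspace k"
  shows "foldr T_op is P \<in> Vspace k \<and> eval_V l (foldr T_op is P) = eval_V l P"
  using assms(1)
proof (induction "is")
  case Nil
  then show ?case
    using P by simp
next
  case (Cons i js)
  then have "1 \<le> i" "Suc i \<le> k" "foldr T_op js P \<in> Vspace k"
    by auto
  then show ?case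
    using T_op_props(1)[of i k] eval_V_T_op[of i k] Cons by simp
qed

lemma d_plus_props:
  assumes F: "F \<in> Vspace k"
  shows "d_plus k F \<in> Vspace (Suc k)" "eval_V (Suc k) (d_plus k F) = eval_V k F"
proof -
  let ?a = "\<lambda>n. yconst (sym_p n) + (Vconst qvar ^ n - 1) * yvar (Suc k) ^ n"
  have G: "Vpleth ?a F \<in> Vspace (Suc k)"
    by (rule Vpleth_Vspace[OF _ _ F]) (auto intro!: Vspace_closed Vspace_yvar)
  \<comment> \<open>On power sums: -q^(n(k+1)) + (q^n - 1) q^(nk) = -q^(nk).\<close>
  have "eval_V (Suc k) (Vpleth ?a F) = eval_V k F"
  proof -
    interpret E: crhom "eval_V (Suc k)"
      by (rule crhom_eval_V)
    have "(eval_V (Suc k) \<circ> Vpleth ?a) F = eval_V k F"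
      by (rule crhom_symfun_ypoly_eqI[OF crhom_comp[OF crhom_eval_V crhom_Vpleth] crhom_eval_V])
        (simp_all add: Vpleth_gens eval_V_gens E.simps algebra_simps power_add flip: power_mult)
    then show ?thesis
      by simp
  qed
  then show "d_plus k F \<in> Vspace (Suc k)" "eval_V (Suc k) (d_plus k F) = eval_V k F"
    using T_op_foldr[OF _ G, of "[1..<Suc k]" "Suc k"] by (simp_all add: d_plus_def del: upt_Suc)
qed

section \<open>The exponential series and the operator d_-\<close>

definition Exp_coeff :: "nat \<Rightarrow> V"
  where "Exp_coeff n = pleth Vconst (\<lambda>n. - yconst (sym_p n)) (sym_h n)"

text \<open>With the sign moved into the coefficient the series has the graded form, and its
  coefficient at u^n is h_n[-X].\<close>

lemma Exp_minus_uX_eq: "Exp_minus_uX = Abs_fps Exp_coeff"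
proof -
  have "- (fps_X ^ n * fps_const (yconst (sym_p n))) =
      fps_X ^ n * fps_const (- yconst (sym_p n) :: V)" for n
    by (simp only: fps_const_neg[symmetric] mult_minus_right)
  then show ?thesis
    unfolding Exp_minus_uX_def Exp_coeff_def by (simp only: pleth_Exp_graded[OF crhom_Vconst])
qed

lemma Exp_coeff_Vspace: "Exp_coeff n \<in> Vspace k"
  unfolding Exp_coeff_def by (rule pleth_Vspace) (intro Vspace_closed)

text \<open>At X = -q^l the expression -X is the single positive term q^l, for which h_n is the n-th
  power.\<close>

lemma eval_V_Exp_coeff: "eval_V l (Exp_coeff n) = (qvar ^ l) ^ n"
proof -
  interpret E: crhom "eval_V l"
    by (rule crhom_eval_V)
  have "is_pleth id (\<lambda>n. (qvar ^ l) ^ n) (eval_V l \<circ> pleth Vconst (\<lambda>n. - yconst (sym_p n)))"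
    by (rule is_plethI[OF crhom_comp[OF crhom_eval_V crhom_pleth[OF crhom_Vconst]]])
      (simp_all add: pleth_sym_const[OF crhom_Vconst] pleth_sym_p[OF crhom_Vconst] eval_V_gens
        E.uminus mult.commute flip: power_mult)
  then have "pleth id (\<lambda>n. (qvar ^ l) ^ n) = eval_V l \<circ> pleth Vconst (\<lambda>n. - yconst (sym_p n))"
    by (rule pleth_eqI[OF crhom_id])
  then have "eval_V l (Exp_coeff n) = pleth id (\<lambda>n. (qvar ^ l) ^ n) (sym_h n)"
    by (simp add: Exp_coeff_def)
  then show ?thesis
    by (simp only: pleth_power_sym_h)
qed

lemma crhom_fls_const_yconst: "crhom (fls_const \<circ> yconst)"
proof -
  have "crhom fls_const"
    by unfold_locales (simp_all add: fls_plus_const)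
  then show ?thesis
    using crhom_yconst by (rule crhom_comp)
qed

lemma crhom_to_laurent: "crhom (to_laurent k)"
  unfolding to_laurent_def by (rule crhom.crhom_ysubst[OF crhom_fls_const_yconst])

lemma to_laurent_gens:
  shows "to_laurent k (yconst a) = fls_const (yconst a)"
    and "to_laurent k (yvar i) = (if i = k then fls_X_inv else fls_const (yvar i))"
  by (simp_all add: to_laurent_def crhom.ysubst_yconst[OF crhom_fls_const_yconst]
      crhom.ysubst_yvar[OF crhom_fls_const_yconst])

text \<open>Multiplication by \<open>y\<^sub>k = u\<^sup>-\<^sup>1\<close> shifts the coefficients, and \<open>Exp[-u X]\<close> evaluates to a geometric
  series, so that taking a coefficient amounts to the evaluation of \<open>y\<^sub>k\<close> at the ratio of that series.\<close>

lemma to_laurent_Exp_coeff: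
  assumes P: "P \<in> Vspace (Suc l)"
  shows "fls_nth (to_laurent (Suc l) P * fps_to_fls Exp_minus_uX) n \<in> Vspace l"
    and "n \<ge> 0 \<Longrightarrow> eval_V l (fls_nth (to_laurent (Suc l) P * fps_to_fls Exp_minus_uX) n) =
      (qvar ^ l) ^ nat n * eval_V l P"
proof -
  interpret L: crhom "to_laurent (Suc l)"
    by (rule crhom_to_laurent)
  interpret E: crhom "eval_V l"
    by (rule crhom_eval_V)
  let ?c = "\<lambda>P. fls_nth (to_laurent (Suc l) P * fps_to_fls Exp_minus_uX)"
  \<comment> \<open>All \<open>n\<close> are treated at once since the last variable shifts the
    index. The geometric formula needs \<open>n \<ge> 0\<close>, a condition that the upward shift
    preserves.\<close>
  have "\<forall>n. ?c P n \<in> Vspace l \<and> (n \<ge> 0 \<longrightarrow> eval_V l (?c P n) = (qvar ^ l) ^ nat n * eval_V l P)"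
    using P
  proof (induction P rule: Vspace_module_induct)
    case one
    then show ?case
      by (simp add: L.one E.one Exp_minus_uX_eq Exp_coeff_Vspace eval_V_Exp_coeff Vspace_0)
  next
    case (const a F)
    have "?c (yconst a * F) n = yconst a * ?c F n" for n
      by (simp add: L.mult to_laurent_gens mult.assoc)
    then show ?case
      using const by (simp add: Vspace_closed E.mult)
  next
    case (var i F)
    show ?case
    proof (cases "i = Suc l")
      case True
      \<comment> \<open>The shift yields one more factor q^l, which is exactly the value of the last
        variable.\<close>
      have "?c (yvar i * F) n = ?c F (n + 1)" for n
        by (simp add: True L.mult to_laurent_gens mult.assoc fls_X_inv_times_conv_shift
              fls_shifted_times_simps)
      then show ?thesis
        using var True by (simp add: E.mult eval_V_gens nat_add_distrib mult_ac)
    next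
      case False
      have "?c (yvar i * F) n = yvar i * ?c F n" for n
        by (simp add: False L.mult to_laurent_gens mult.assoc)
      moreover have "yvar i \<in> Vspace l"
        using var(1) False by (intro Vspace_yvar) auto
      ultimately show ?thesis
        using var by (simp add: Vspace_mult E.mult)
    qed
  next
    case (add F G)
    have "?c (F + G) n = ?c F n + ?c G n" for n
      by (simp add: L.add distrib_right)
    then show ?case
      using add by (simp add: Vspace_add E.add distrib_left)
  qed
  then show "?c P n \<in> Vspace l" "n \<ge> 0 \<Longrightarrow> eval_V l (?c P n) = (qvar ^ l) ^ nat n * eval_V l P"
    by auto
qed

text \<open>On power sums the shift gives -q^(nl) - (q^n - 1) q^(nl) = -q^(n(l+1)), so
  \<open>eval_V l\<close> becomes \<open>eval_V (Suc l)\<close>. The coefficient at u^1 adds the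
  factor q^l, and the sign comes from the definition of \<open>d_minus\<close>.\<close>

lemma d_minus_props:
  assumes F: "F \<in> Vspace (Suc l)"
  shows "d_minus (Suc l) F \<in> Vspace l" "eval_V l (d_minus (Suc l) F) = - (qvar ^ l) * eval_V (Suc l) F"
proof -
  interpret E: crhom "eval_V l"
    by (rule crhom_eval_V)
  let ?a = "\<lambda>n. yconst (sym_p n) - (Vconst qvar ^ n - 1) * yvar (Suc l) ^ n"
  have G: "Vpleth ?a F \<in> Vspace (Suc l)"
    by (rule Vpleth_Vspace[OF _ _ F]) (auto intro!: Vspace_closed Vspace_yvar)
  have "(eval_V l \<circ> Vpleth ?a) F = eval_V (Suc l) F"
    by (rule crhom_symfun_ypoly_eqI[OF crhom_comp[OF crhom_eval_V crhom_Vpleth] crhom_eval_V])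
      (simp_all add: Vpleth_gens eval_V_gens E.simps algebra_simps power_add flip: power_mult)
  then show "d_minus (Suc l) F \<in> Vspace l"
    "eval_V l (d_minus (Suc l) F) = - (qvar ^ l) * eval_V (Suc l) F"
    using to_laurent_Exp_coeff[OF G, of 1] by (simp_all add: d_minus_def Vspace_uminus E.uminus)
qed

section \<open>Dyck paths\<close>

text \<open>Excludes d_- at level 0, which the truncated subtraction in \<open>level\<close> would
  conceal.\<close>

fun admissible :: "sign list \<Rightarrow> nat \<Rightarrow> bool" where
  "admissible [] k \<longleftrightarrow> True"
| "admissible (Plus # es) k \<longleftrightarrow> admissible es k"
| "admissible (Minus # es) k \<longleftrightarrow> level es k > 0 \<and> admissible es k"

text \<open>\<open>minus_weight\<close> is the exponent of \<open>q\<close> produced by the operators \<open>d\<^sub>-\<close>, a sum over the North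
  steps; \<open>plus_weight\<close> is the corresponding sum over the East steps, which counts the cells under
  the path column by column.\<close>

fun minus_weight :: "sign list \<Rightarrow> nat \<Rightarrow> nat" where
  "minus_weight [] k = 0"
| "minus_weight (Plus # es) k = minus_weight es k"
| "minus_weight (Minus # es) k = (level es k - 1) + minus_weight es k"

fun plus_weight :: "sign list \<Rightarrow> nat \<Rightarrow> nat" where
  "plus_weight [] k = 0"
| "plus_weight (Plus # es) k = level es k + plus_weight es k"
| "plus_weight (Minus # es) k = plus_weight es k"

lemma apply_signs_props:
  assumes "admissible es k" "f \<in> Vspace k"
  shows "apply_signs es k f \<in> Vspace (level es k) \<and>
    eval_V (level es k) (apply_signs es k f) =
      (- 1) ^ count_list es Minus * qvar ^ minus_weight es k * eval_V k f"
  using assms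
proof (induction es k rule: admissible.induct)
  case (2 es k)
  then show ?case
    using d_plus_props[of "apply_signs es k f" "level es k"] by simp
next
  case (3 es k)
  then obtain l where "level es k = Suc l"
    by (cases "level es k") auto
  with 3 show ?case
    using d_minus_props[of "apply_signs es k f" l] by (simp add: power_add mult_ac flip: power_mult)
qed simp

text \<open>Both weights telescope against \<open>level choose 2\<close>.\<close>

lemma minus_weight_eq_plus_weight:
  assumes "admissible es k"
  shows "(level es k choose 2) + minus_weight es k = plus_weight es k + (k choose 2)"
  using assms
proof (induction es k rule: admissible.induct)
  case (3 es k)
  then obtain l where "level es k = Suc l"
    by (cases "level es k") auto
  with 3 show ?case
    by (simp add: numeral_2_eq_2)
qed (simp_all add: numeral_2_eq_2)

section \<open>Sign sequences of Dyck paths\<close>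

lemma level_replicate_Plus: "level (replicate k Plus) 0 = k"
  by (induction k) simp_all

lemma minus_weight_replicate_Plus: "minus_weight (replicate k Plus) l = 0"
  by (induction k) simp_all

lemma level_append: "level (es @ es') k = level es (level es' k)"
  by (induction es k rule: admissible.induct) simp_all

lemma admissible_append: "admissible (es @ es') k \<longleftrightarrow> admissible es (level es' k) \<and> admissible es' k"
  by (induction es k rule: admissible.induct) (auto simp: level_append)

text \<open>Operators act from the right, so levels are read off suffixes, on which the Dyck
  condition says that East steps are at least as many as North steps.\<close>

lemma admissible_map_step_sign:
  assumes "\<forall>m\<le>length \<pi>. count_list (drop m \<pi>) North \<le> count_list (drop m \<pi>) East"
  shows "admissible (map step_sign \<pi>) 0 \<and>
    level (map step_sign \<pi>) 0 = count_list \<pi> East - count_list \<pi> North"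
  using assms
proof (induction \<pi>)
  case (Cons s \<pi>)
  have "count_list (drop m \<pi>) North \<le> count_list (drop m \<pi>) East" if "m \<le> length \<pi>" for m
    using Cons.prems[rule_format, of "Suc m"] that by simp
  \<comment> \<open>The instance 0 gives the positive level before a North step; the instance 1
    keeps the truncated difference exact at an East step.\<close>
  with Cons.IH Cons.prems[rule_format, of 0] Cons.prems[rule_format, of 1] show ?case
    by (cases s) auto
qed simp

lemma plus_weight_map_step_sign:
  "plus_weight (map step_sign \<pi>) k =
    (\<Sum>m<length \<pi>. if \<pi> ! m = East then level (map step_sign (drop (Suc m) \<pi>)) k else 0)"
proof (induction \<pi>)
  case (Cons s \<pi>)
  then show ?case
    by (cases s) (simp_all add: sum.lessThan_Suc_shift del: sum.lessThan_Suc cong: if_cong)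
qed simp

lemma count_list_step_sign: "count_list (map step_sign \<pi>) Minus = count_list \<pi> North"
proof (induction \<pi>)
  case (Cons s \<pi>)
  then show ?case
    by (cases s) simp_all
qed simp

lemma xpos_Suc: "m < length \<pi> \<Longrightarrow> xpos \<pi> (Suc m) = xpos \<pi> m + (if \<pi> ! m = East then 1 else 0)"
  by (simp add: xpos_def take_Suc_conv_app_nth)

lemma ypos_Suc: "m < length \<pi> \<Longrightarrow> ypos \<pi> (Suc m) = ypos \<pi> m + (if \<pi> ! m = North then 1 else 0)"
  by (simp add: ypos_def take_Suc_conv_app_nth)

lemma xpos_mono: "m \<le> n \<Longrightarrow> xpos \<pi> m \<le> xpos \<pi> n"
proof -
  assume "m \<le> n"
  then have "take n \<pi> = take m \<pi> @ take (n - m) (drop m \<pi>)"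
    by (metis le_add_diff_inverse take_add)
  then show ?thesis
    by (simp add: xpos_def)
qed

text \<open>Cells are grouped by column: each column has at most one East step, since the abscissa
  grows strictly at such a step.\<close>

lemma area_eq_sum:
  "area \<pi> = (\<Sum>m<length \<pi>. if \<pi> ! m = East then ypos \<pi> m - xpos \<pi> (Suc m) else 0)"
proof -
  let ?E = "{m. m < length \<pi> \<and> \<pi> ! m = East}"
  \<comment> \<open>The interval is open below because \<open>i < j\<close> is strict and closed
    above because a cell may touch the path.\<close>
  let ?S = "SIGMA m:?E. {xpos \<pi> (Suc m)<..ypos \<pi> m}"
  let ?f = "\<lambda>(m, j). (xpos \<pi> (Suc m), j)"
  have less: "xpos \<pi> (Suc m) < xpos \<pi> (Suc n)" if "n \<in> ?E" "m < n" for m n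
    using that xpos_mono[of "Suc m" n \<pi>] by (simp add: xpos_Suc)
  have "m = n" if "m \<in> ?E" "n \<in> ?E" "xpos \<pi> (Suc m) = xpos \<pi> (Suc n)" for m n
    using that less[of m n] less[of n m] by (cases m n rule: linorder_cases) auto
  then have inj: "inj_on ?f ?S"
    by (auto simp: inj_on_def)
  have "{(i, j). i < j \<and> cell_under \<pi> i j} = ?f ` ?S"
    by (force simp: cell_under_def)
  then have "area \<pi> = card ?S"
    by (simp add: area_def card_image[OF inj])
  also have "\<dots> = (\<Sum>m\<in>?E. ypos \<pi> m - xpos \<pi> (Suc m))"
    by (subst card_SigmaI) auto
  also have "\<dots> = (\<Sum>m<length \<pi>. if \<pi> ! m = East then ypos \<pi> m - xpos \<pi> (Suc m) else 0)"
    by (rule sum.mono_neutral_cong_left) auto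
  finally show ?thesis .
qed

lemma dyck_path_signs:
  assumes "dyck_path N \<pi>"
  shows "admissible (map step_sign \<pi>) 0" "level (map step_sign \<pi>) 0 = 0"
    and "count_list (map step_sign \<pi>) Minus = N" "plus_weight (map step_sign \<pi>) 0 = area \<pi>"
proof -
  have tot: "count_list \<pi> East = N" "count_list \<pi> North = N"
    and le: "\<And>m. m \<le> length \<pi> \<Longrightarrow> xpos \<pi> m \<le> ypos \<pi> m"
    using assms by (auto simp: dyck_path_def xpos_def ypos_def)
  have drop: "xpos \<pi> m + count_list (drop m \<pi>) East = N" "ypos \<pi> m + count_list (drop m \<pi>) North = N" for m
    unfolding xpos_def ypos_def using tot
    by (metis append_take_drop_id count_list_append)+
  have suffix: "count_list (drop m \<pi>) North \<le> count_list (drop m \<pi>) East" if "m \<le> length \<pi>" for m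
    using le[OF that] drop[of m] by linarith
  show "admissible (map step_sign \<pi>) 0" "level (map step_sign \<pi>) 0 = 0"
    using admissible_map_step_sign[of \<pi>] suffix tot by auto
  show "count_list (map step_sign \<pi>) Minus = N"
    by (simp add: count_list_step_sign tot)
  have level: "level (map step_sign (drop m \<pi>)) 0 = ypos \<pi> m - xpos \<pi> m" if "m \<le> length \<pi>" for m
  proof -
    have "\<forall>n\<le>length (drop m \<pi>). count_list (drop n (drop m \<pi>)) North \<le> count_list (drop n (drop m \<pi>)) East"
      using suffix that by (simp add: add.commute)
    then have "level (map step_sign (drop m \<pi>)) 0 = count_list (drop m \<pi>) East - count_list (drop m \<pi>) North"
      using admissible_map_step_sign by blast
    then show ?thesis
      using drop[of m] by linarith
  qed
  show "plus_weight (map step_sign \<pi>) 0 = area \<pi>"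
    \<comment> \<open>The level to the right of an East step \<open>m\<close> is measured at
      \<open>Suc m\<close>; the height there is still \<open>ypos \<pi> m\<close>.\<close>
    unfolding plus_weight_map_step_sign area_eq_sum by (rule sum.cong) (auto simp: level ypos_Suc)
qed

text \<open>For level 0 one has -q^(n*0) = -1 and no variables remain, so the substitution of the
  theorem is \<open>eval_V 0\<close> embedded as a constant.\<close>

lemma pleth_minus_one_Vspace_0:
  assumes "G \<in> Vspace 0"
  shows "ysubst (pleth yconst (\<lambda>n. -1)) yvar G = yconst (eval_V 0 G)"
proof -
  have hom: "crhom (yconst :: qtfield \<Rightarrow> qtfield ypoly)"
    by (rule crhom_yconst)
  interpret y: crhom "yconst :: qtfield \<Rightarrow> qtfield ypoly"
    by (rule hom)
  interpret p: crhom "pleth (yconst :: qtfield \<Rightarrow> qtfield ypoly) (\<lambda>n. -1)"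
    by (rule crhom_pleth[OF hom])
  interpret L: crhom "ysubst (pleth (yconst :: qtfield \<Rightarrow> qtfield ypoly) (\<lambda>n. -1)) yvar"
    by (rule p.crhom_ysubst)
  interpret E: crhom "eval_V 0"
    by (rule crhom_eval_V)
  interpret yV: crhom "yconst :: qtfield symfun \<Rightarrow> V"
    by (rule crhom_yconst)
  have yconst: "pleth yconst (\<lambda>n. -1) F = yconst (eval_V 0 (yconst F))" for F
    by (induction F rule: symfun_induct)
      (simp_all add: pleth_sym_const[OF hom] pleth_sym_p[OF hom] eval_V_gens y.simps p.simps
        E.simps yV.simps del: One_nat_def)
  show ?thesis
    using assms
  proof (induction G rule: Vspace_induct)
    case (const a)
    then show ?case
      by (rule trans[OF p.ysubst_yconst yconst])
  qed (simp_all add: L.simps E.simps y.simps)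
qed

theorem proposition4p14:
  fixes N k :: nat and \<pi> :: "step list" and \<epsilon> :: "sign list" and f :: V
  assumes "dyck_path N \<pi>"
    and "map step_sign \<pi> = \<epsilon> @ replicate k Plus"
    and "f \<in> Vspace k"
  shows "ysubst (pleth yconst (\<lambda>n. -1)) yvar (apply_signs \<epsilon> k f) =
    yconst ((-1) ^ N * qvar ^ area \<pi> *
      ysubst (pleth id (\<lambda>n. - (qvar ^ (n * k)))) (\<lambda>i. qvar ^ (i - 1)) f)"
proof -
  note signs = dyck_path_signs[OF assms(1)]
  have adm: "admissible \<epsilon> k" and level: "level \<epsilon> k = 0"
    using signs(1,2) by (simp_all add: assms(2) admissible_append level_append level_replicate_Plus)
  have "count_list (replicate k Plus) Minus = 0"
    by (induction k) simp_all
  then have N: "count_list \<epsilon> Minus = N"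
    using signs(3) by (simp add: assms(2))
  \<comment> \<open>The final \<open>k\<close> East steps raise the level from 0 to \<open>k\<close>
    and carry no minus weight, so the full path may be used instead.\<close>
  have "minus_weight \<epsilon> k = minus_weight (\<epsilon> @ replicate k Plus) 0"
    by (induction \<epsilon> k rule: admissible.induct)
      (simp_all add: level_append level_replicate_Plus minus_weight_replicate_Plus)
  \<comment> \<open>The full path starts and ends at level 0, so both binomial terms vanish and the
    two weights agree.\<close>
  also have "\<dots> = area \<pi>"
    using minus_weight_eq_plus_weight[OF signs(1)] signs(2,4) by (simp add: assms(2))
  finally have "eval_V 0 (apply_signs \<epsilon> k f) = (-1) ^ N * qvar ^ area \<pi> * eval_V k f"
    "apply_signs \<epsilon> k f \<in> Vspace 0"
    using apply_signs_props[OF adm assms(3)] by (simp_all add: level N)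
  then show ?thesis
    by (simp add: pleth_minus_one_Vspace_0 eval_V_def)
qed

end
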